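(* Let $k\ge1$, $\boldsymbol{\alpha}=(\alpha_1,\dots,\alpha_k)\in(0,+\infty)^k$, $\beta\in(0,+\infty)$. Let $\mathbf{X}_n=(X_{1n},\dots,X_{kn})$, $n\in[N]$, be a random sample from the Multivariate Gamma distribution $\mathcal{MG}_k(\boldsymbol{\alpha},\beta)$ and $\mathbf{Z}_n=(Z_{1n},\dots,Z_{kn}):=\Delta\mathbf{X}_n$, $n\in[N]$. The Score-Adjusted Moment Estimator $$\breve\beta=\frac1k\sum_{j=1}^k\left[\overline{Z_j\log Z_j}-\overline{Z_j}\;\overline{\log Z_j}\right],\qquad\breve\alpha_i=\frac{\overline{Z_i}}{\breve\beta},\quad i\in[k],$$ is a moment-type estimator of $(\boldsymbol{\alpha},\beta)$ with functions $$h(\mathbf{x})=(z_1,\dots,z_k,\log z_1,\dots,\log z_k,z_1\log z_1,\dots,z_k\log z_k),$$ $$g_i(\mathbf{y})=\frac{y_i}{g_{k+1}(\mathbf{y})},\ i\in[k],\qquad g_{k+1}(\mathbf{y})=\frac1k\sum_{j=1}^k(y_{2k+j}-y_jy_{k+j}),$$ where $\mathbf{z}=(z_1,\dots,z_k):=\Delta\mathbf{x}$. Its asymptotic variance-covariance matrix is $\mathbf{G}\mathbf{V}\mathbf{G}^\top$, where $\mathbf{V}=v_h(\boldsymbol{\alpha},\beta)$ is the $3k\times3k$ variance-covariance matrix of $h(\mathbf{X})$, $\mathbf{X}\sim\mathcal{MG}_k(\boldsymbol{\alpha},\beta)$, and $\mathbf{G}$ is the $(k+1)\times3k$ block matrix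 $$\mathbf{G}=\begin{bmatrix}\mathbf{G}_{11}&\mathbf{G}_{12}&\mathbf{G}_{13}\\ \mathbf{G}_{21}&\mathbf{G}_{22}&\mathbf{G}_{23}\end{bmatrix}$$ with $\mathbf{G}_{11},\mathbf{G}_{12},\mathbf{G}_{13}$ of size $k\times k$ and $\mathbf{G}_{21},\mathbf{G}_{22},\mathbf{G}_{23}$ of size $1\times k$ such that, for $i,j\in[k]$, $$(\mathbf{G}_{11})_{ij}=\frac{\alpha_i}{k\beta}\left[\psi(\alpha_j)+\log\beta\right]+\frac1\beta\mathbb{I}_{\{i=j\}},\qquad(\mathbf{G}_{12})_{ij}=\frac{\alpha_i\alpha_j}{k},\qquad(\mathbf{G}_{13})_{ij}=-\frac{\alpha_i}{k\beta},$$ $$(\mathbf{G}_{21})_j=-\frac1k\left[\psi(\alpha_j)+\log\beta\right],\qquad(\mathbf{G}_{22})_j=-\frac1k\alpha_j\beta,\qquad(\mathbf{G}_{23})_j=\frac1k.$$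
   Context: Notation: $[k]=\{1,\dots,k\}$; $\mathbb{I}$ is the indicator; a random sample is an i.i.d. sample; $\overline{h(\mathbf{X})}:=\frac1N\sum_{n=1}^N h(\mathbf{X}_n)$, so e.g. $\overline{Z_j\log Z_j}=\frac1N\sum_n Z_{jn}\log Z_{jn}$. $\Delta\mathbf{x}:=(x_1,x_2-x_1,\dots,x_k-x_{k-1})$. $e_h(\boldsymbol{\theta})=\mathbb{E}_{\boldsymbol{\theta}}(h(\mathbf{X}))$ and $v_h(\boldsymbol{\theta})=\mathbb{V}_{\boldsymbol{\theta}}(h(\mathbf{X}))$ (variance-covariance matrix). $\Gamma$ is the gamma function and $\psi(a)=\frac{d}{da}\log\Gamma(a)$ the digamma function. Multivariate Gamma distribution: $\mathbf{X}\sim\mathcal{MG}_k(\boldsymbol{\alpha},\beta)$ has Lebesgue density on $\mathbb{R}^k$ $f(\mathbf{x};\boldsymbol{\alpha},\beta)=\frac{1}{\beta^{\alpha_0}\prod_{i=1}^k\Gamma(\alpha_i)}e^{-x_k/\beta}x_1^{\alpha_1-1}\prod_{i=2}^k(x_i-x_{i-1})^{\alpha_i-1}$ on $\{\mathbf{x}\in(0,+\infty)^k:x_1<x_2<\dots<x_k\}$, where $\alpha_0=\sum_{i=1}^k\alpha_i$. Moment-type estimator: for a parametric family with support $\mathbf{S}\subset\mathbb{R}^k$ and parameter space $\boldsymbol{\Theta}\subset\mathbb{R}^d$, let $h:\mathbf{S}\to\mathbb{R}^m$ be such that $e_h:\boldsymbol{\Theta}\to\mathbb{R}^m$ is injective,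 and let $g:\mathbb{R}^m\to\mathbb{R}^d$ satisfy $g|_{e_h(\boldsymbol{\Theta})}=e_h^{-1}$. The estimator $\tilde{\boldsymbol{\theta}}_N=g(\overline{h(\mathbf{X})})$ is called a moment-type estimator of $\boldsymbol{\theta}$ (with functions $h,g$); it exists as long as $\tilde{\boldsymbol{\theta}}_N\in\boldsymbol{\Theta}$. A function $g$ given by a formula is understood to be defined arbitrarily where the formula is undefined. Here $\boldsymbol{\theta}=(\boldsymbol{\alpha},\beta)$, $\boldsymbol{\Theta}=(0,+\infty)^{k+1}$. An estimator $\tilde{\boldsymbol{\theta}}_N$ that exists with probability tending to 1 as $N\to\infty$ has asymptotic variance-covariance matrix $\boldsymbol{\Sigma}$ if $\sqrt{N}(\tilde{\boldsymbol{\theta}}_N-\boldsymbol{\theta})$ converges in law, under $\boldsymbol{\theta}$, to the centered normal distribution with covariance matrix $\boldsymbol{\Sigma}$ as $N\to\infty$. *)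

theory Defs
  imports "HOL-Probability.Probability"
begin

text \<open>
  The index set \<open>{1, \<dots>, k}\<close> is a type \<open>'k\<close> of sort \<open>{finite, wellorder}\<close>: a nonempty finite
  linear order, whose only invariant is \<open>k = CARD('k) \<ge> 1\<close>. Its last element is \<open>Max UNIV\<close>.
  Parameters \<open>(\<alpha>, \<beta>)\<close> live in \<open>real ^ ('k + unit)\<close>, i.e. dimension \<open>k + 1\<close>, and \<open>h\<close> takes values
  in \<open>real ^ ('k + 'k + 'k)\<close>, i.e. dimension \<open>3k\<close>; the summands are the blocks.
\<close>

section \<open>General notions\<close>

definition sample_mean :: "nat \<Rightarrow> (nat \<Rightarrow> 'b::real_vector) \<Rightarrow> 'b" where
  "sample_mean N y = (1 / real N) *\<^sub>R (\<Sum>n<N. y n)"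

definition cov_matrix :: "'s measure \<Rightarrow> ('s \<Rightarrow> real ^ 'm) \<Rightarrow> real ^ 'm ^ 'm" where
  "cov_matrix M Y = (\<chi> i j. LINT x|M. (Y x $ i - (LINT y|M. Y y $ i)) * (Y x $ j - (LINT y|M. Y y $ j)))"

text \<open>
  A statistic is a family \<open>T N x\<close>, where \<open>N\<close> is the sample size and only the observations
  \<open>x 0, \<dots>, x (N - 1)\<close> matter. Integrability of \<open>h\<close> is part of the definition because \<open>e\<^sub>h\<close> has to
  be defined on all of \<open>\<Theta>\<close>.
\<close>

definition moment_type_estimator ::
  "(real ^ 'd \<Rightarrow> (real ^ 'k) measure) \<Rightarrow> (real ^ 'd) set \<Rightarrow> (real ^ 'k) set \<Rightarrow>
   (real ^ 'k \<Rightarrow> real ^ 'm) \<Rightarrow> (real ^ 'm \<Rightarrow> real ^ 'd) \<Rightarrow>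
   (nat \<Rightarrow> (nat \<Rightarrow> real ^ 'k) \<Rightarrow> real ^ 'd) \<Rightarrow> bool" where
  "moment_type_estimator P \<Theta> S h g T \<longleftrightarrow>
     (let e = (\<lambda>\<theta>. LINT x|P \<theta>. h x) in
       (\<forall>\<theta>\<in>\<Theta>. integrable (P \<theta>) h) \<and>
       inj_on e \<Theta> \<and>
       (\<forall>y\<in>e ` \<Theta>. g y = inv_into \<Theta> e y) \<and>
       (\<forall>N\<ge>1. \<forall>x. (\<forall>n<N. x n \<in> S) \<longrightarrow> T N x = g (sample_mean N (\<lambda>n. h (x n)))))"

text \<open>
  The normal distribution \<open>N(0, \<Sigma>)\<close>, for possibly singular \<open>\<Sigma>\<close>: every linear functional
  \<open>a \<bullet> x\<close> has the univariate law \<open>N(0, a\<^sup>T \<Sigma> a)\<close>, where \<open>N(0, 0)\<close> is the point mass at 0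
  (\<open>normal_density\<close> takes the standard deviation and does not cover that case).
\<close>

definition is_centered_normal :: "(real ^ 'd) measure \<Rightarrow> real ^ 'd ^ 'd \<Rightarrow> bool" where
  "is_centered_normal \<mu> \<Sigma> \<longleftrightarrow>
     sets \<mu> = sets borel \<and> transpose \<Sigma> = \<Sigma> \<and>
     (\<forall>a. 0 \<le> a \<bullet> (\<Sigma> *v a) \<and>
       distr \<mu> borel (\<lambda>x. a \<bullet> x) =
         (if a \<bullet> (\<Sigma> *v a) = 0 then return borel 0
          else density lborel (\<lambda>t. ennreal (normal_density 0 (sqrt (a \<bullet> (\<Sigma> *v a))) t))))"

definition converges_in_law ::
  "'a measure \<Rightarrow> (nat \<Rightarrow> 'a \<Rightarrow> real ^ 'd) \<Rightarrow> (real ^ 'd) measure \<Rightarrow> bool" where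
  "converges_in_law M Y \<mu> \<longleftrightarrow>
     (\<forall>N. Y N \<in> borel_measurable M) \<and>
     (\<forall>f :: real ^ 'd \<Rightarrow> real. continuous_on UNIV f \<and> bounded (range f) \<longrightarrow>
        (\<lambda>N. LINT \<omega>|M. f (Y N \<omega>)) \<longlonglongrightarrow> (LINT x|\<mu>. f x))"

text \<open>
  \<open>T N\<close> is the estimator of \<open>\<theta>\<close> for sample size \<open>N\<close>, as a random vector on the probability space
  \<open>M\<close>; it exists where its value lies in \<open>\<Theta>\<close>.
\<close>

definition has_asymptotic_cov ::
  "'a measure \<Rightarrow> (nat \<Rightarrow> 'a \<Rightarrow> real ^ 'd) \<Rightarrow> (real ^ 'd) set \<Rightarrow> real ^ 'd \<Rightarrow> real ^ 'd ^ 'd \<Rightarrow> bool" where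
  "has_asymptotic_cov M T \<Theta> \<theta> \<Sigma> \<longleftrightarrow>
     (\<lambda>N. measure M {\<omega> \<in> space M. T N \<omega> \<in> \<Theta>}) \<longlonglongrightarrow> 1 \<and>
     (\<exists>\<mu>. is_centered_normal \<mu> \<Sigma> \<and>
          converges_in_law M (\<lambda>N \<omega>. sqrt (real N) *\<^sub>R (T N \<omega> - \<theta>)) \<mu>)"

section \<open>The Multivariate Gamma distribution\<close>

definition increments :: "real ^ 'k::{finite,wellorder} \<Rightarrow> real ^ 'k::_" where
  "increments x = (\<chi> i. if {j. j < i} = {} then x $ i else x $ i - x $ Max {j. j < i})"

definition mg_support :: "(real ^ 'k::{finite,wellorder}) set" where
  "mg_support = {x. (\<forall>i. 0 < x $ i) \<and> (\<forall>i j. i < j \<longrightarrow> x $ i < x $ j)}"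

definition mg_density :: "real ^ 'k::{finite,wellorder} \<Rightarrow> real \<Rightarrow> real ^ 'k::_ \<Rightarrow> real" where
  "mg_density \<alpha> \<beta> x =
     (if x \<in> mg_support
      then 1 / (\<beta> powr (\<Sum>i\<in>UNIV. \<alpha> $ i) * (\<Prod>i\<in>UNIV. Gamma (\<alpha> $ i)))
           * exp (- (x $ Max UNIV) / \<beta>) * (\<Prod>i\<in>UNIV. (increments x $ i) powr (\<alpha> $ i - 1))
      else 0)"

definition mg_param :: "real ^ 'k::finite \<Rightarrow> real \<Rightarrow> real ^ ('k + unit)" where
  "mg_param \<alpha> \<beta> = (\<chi> i. case i of Inl j \<Rightarrow> \<alpha> $ j | Inr _ \<Rightarrow> \<beta>)"

definition mg_param_space :: "(real ^ ('k::finite + unit)) set" where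
  "mg_param_space = {\<theta>. \<forall>i. 0 < \<theta> $ i}"

definition mg_measure :: "real ^ ('k::{finite,wellorder} + unit) \<Rightarrow> (real ^ 'k::_) measure" where
  "mg_measure \<theta> = density lborel (\<lambda>x. ennreal (mg_density (\<chi> j. \<theta> $ Inl j) (\<theta> $ Inr ()) x))"

section \<open>The Score-Adjusted Moment Estimator\<close>

text \<open>
  Quotients with zero denominator take the value 0, which is one way of extending the formulas to
  where they are undefined.
\<close>

definition same_beta :: "nat \<Rightarrow> (nat \<Rightarrow> real ^ 'k::{finite,wellorder}) \<Rightarrow> real" where
  "same_beta N x = (1 / real CARD('k)) *
     (\<Sum>j\<in>UNIV. (sample_mean N (\<lambda>n. increments (x n) $ j * ln (increments (x n) $ j))
        - sample_mean N (\<lambda>n. increments (x n) $ j) * sample_mean N (\<lambda>n. ln (increments (x n) $ j))))"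

definition same_alpha :: "nat \<Rightarrow> (nat \<Rightarrow> real ^ 'k::{finite,wellorder}) \<Rightarrow> real ^ 'k::_" where
  "same_alpha N x = (\<chi> i. sample_mean N (\<lambda>n. increments (x n) $ i) / same_beta N x)"

definition same_estimator ::
  "nat \<Rightarrow> (nat \<Rightarrow> real ^ 'k::{finite,wellorder}) \<Rightarrow> real ^ ('k + unit)" where
  "same_estimator N x = mg_param (same_alpha N x) (same_beta N x)"

definition same_h :: "real ^ 'k::{finite,wellorder} \<Rightarrow> real ^ ('k + 'k + 'k)" where
  "same_h x = (\<chi> i. case i of
       Inl j \<Rightarrow> increments x $ j
     | Inr (Inl j) \<Rightarrow> ln (increments x $ j)
     | Inr (Inr j) \<Rightarrow> increments x $ j * ln (increments x $ j))"

definition same_g :: "real ^ ('k::finite + 'k + 'k) \<Rightarrow> real ^ ('k + unit)" where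
  "same_g y =
     (let b = (1 / real CARD('k)) * (\<Sum>j\<in>UNIV. (y $ Inr (Inr j) - y $ Inl j * y $ Inr (Inl j)))
      in mg_param (\<chi> i. y $ Inl i / b) b)"

definition same_G :: "real ^ 'k::finite \<Rightarrow> real \<Rightarrow> real ^ ('k + 'k + 'k) ^ ('k + unit)" where
  "same_G \<alpha> \<beta> = (let k = real CARD('k) in
     (\<chi> r c. case r of
        Inl i \<Rightarrow> (case c of
            Inl j \<Rightarrow> \<alpha> $ i / (k * \<beta>) * (Digamma (\<alpha> $ j) + ln \<beta>) + (1 / \<beta>) * (if i = j then 1 else 0)
          | Inr (Inl j) \<Rightarrow> \<alpha> $ i * \<alpha> $ j / k
          | Inr (Inr j) \<Rightarrow> - (\<alpha> $ i / (k * \<beta>)))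
      | Inr _ \<Rightarrow> (case c of
            Inl j \<Rightarrow> - (1 / k) * (Digamma (\<alpha> $ j) + ln \<beta>)
          | Inr (Inl j) \<Rightarrow> - (1 / k) * \<alpha> $ j * \<beta>
          | Inr (Inr j) \<Rightarrow> 1 / k)))"

end

theory Submission
  imports Defs
begin

text \<open>
  Under the Multivariate Gamma distribution the increments \<open>z j\<close> are independent Gamma variables with
  shapes \<open>\<alpha> $ j\<close> and common scale \<open>\<beta>\<close>: the linear map to the increments is unit lower triangular, so it
  preserves Lebesgue measure, and in these coordinates the density factorises
  (\<open>lborel_distr_increments\<close>, \<open>mg_density_eq_prod_gamma_density\<close>). For a Gamma variable \<open>z\<close> the means of
  \<open>z\<close>, \<open>ln z\<close> and \<open>z * ln z\<close> are explicit (\<open>gamma_law_moments\<close>), and they show that the covariance of \<open>z\<close>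
  and \<open>ln z\<close> is exactly \<open>\<beta>\<close>. This is why averaging the empirical covariances of \<open>z j\<close> and \<open>ln (z j)\<close>
  estimates \<open>\<beta>\<close>: the function \<open>same_g\<close> inverts the moment map (\<open>same_g_mg_h_mean\<close>), which makes the
  estimator a moment-type estimator.

  The estimator is thus \<open>same_g\<close> of a sample mean of independent identically distributed square
  integrable vectors, and its asymptotic covariance matrix comes from the delta method
  (\<open>delta_method_iid\<close>) with the Jacobian of \<open>same_g\<close> at the mean (\<open>same_g_has_derivative\<close>).

  The delta method needs a multivariate central limit theorem, which is reduced to the
  one-dimensional one. Along each linear functional the latter gives the limit of the expectations of
  cosines, a bounded second moment gives tightness, and the two together imply convergence in law: on
  compact sets a continuous function is approximated by trigonometric polynomials, by the
  Stone--Weierstrass theorem (\<open>expectation_tendsto_of_cos\<close>). The limit law exists even for a singular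
  covariance matrix, because a positive semidefinite matrix is a sum of outer squares of vectors
  (\<open>centered_normal_exists\<close>).
\<close>

section \<open>Convergence in law from cosines and tightness\<close>

text \<open>
  The limit arguments below all split an expectation in this way: the integrand is small outside an
  event of small probability, and bounded on that event.
\<close>

lemma (in prob_space) abs_expectation_le_off_event:
  fixes f :: "'a \<Rightarrow> real"
  assumes "f \<in> borel_measurable M" and A[measurable]: "A \<in> events" and "0 \<le> e"
    and small: "\<And>\<omega>. \<omega> \<in> space M \<Longrightarrow> \<omega> \<notin> A \<Longrightarrow> \<bar>f \<omega>\<bar> \<le> e"
    and bound: "\<And>\<omega>. \<omega> \<in> space M \<Longrightarrow> \<bar>f \<omega>\<bar> \<le> C"
  shows "\<bar>expectation f\<bar> \<le> e + C * prob A"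
proof -
  have "\<bar>expectation f\<bar> \<le> expectation (\<lambda>\<omega>. \<bar>f \<omega>\<bar>)"
    by (rule integral_abs_bound)
  also have "\<dots> \<le> expectation (\<lambda>\<omega>. e + C * indicator A \<omega>)"
  proof (rule integral_mono)
    show "integrable M (\<lambda>\<omega>. \<bar>f \<omega>\<bar>)"
      using assms(1) bound by (intro integrable_const_bound[where B = C]) auto
    show "integrable M (\<lambda>\<omega>. e + C * indicator A \<omega> :: real)"
      by (auto intro!: integrable_real_indicator simp: emeasure_eq_measure)
    show "\<bar>f \<omega>\<bar> \<le> e + C * indicator A \<omega>" if "\<omega> \<in> space M" for \<omega>
      using small[OF that] bound[OF that] \<open>0 \<le> e\<close> by (auto simp: indicator_def)
  qed
  also have "\<dots> = e + C * prob A"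
    by (subst Bochner_Integration.integral_add)
       (auto simp: prob_space emeasure_eq_measure)
  finally show ?thesis .
qed

text \<open>
  The real trigonometric polynomials on an inner product space. Sines (\<open>s = - pi / 2\<close>) and constants
  (\<open>t = 0\<close>) are among the generators, so that no other kind is needed.
\<close>

inductive_set trig_polys :: "('a::real_inner \<Rightarrow> real) set" where
  mono: "(\<lambda>x. c * cos (t \<bullet> x + s)) \<in> trig_polys"
| add: "f \<in> trig_polys \<Longrightarrow> g \<in> trig_polys \<Longrightarrow> (\<lambda>x. f x + g x) \<in> trig_polys"

lemma trig_polys_const: "(\<lambda>_. c) \<in> trig_polys"
  using trig_polys.mono[of c 0 0] by simp

text \<open>
  The product-to-sum formula for cosines makes the span of the generators an algebra, which is what
  the Stone--Weierstrass theorem asks for.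
\<close>

lemma trig_polys_mult_mono:
  assumes "f \<in> trig_polys"
  shows "(\<lambda>x. f x * (c * cos (t \<bullet> x + s))) \<in> trig_polys"
  using assms
proof induction
  case (mono d u r)
  have "(\<lambda>x. (d * cos (u \<bullet> x + r)) * (c * cos (t \<bullet> x + s))) =
        (\<lambda>x. (d * c / 2) * cos ((u - t) \<bullet> x + (r - s)) + (d * c / 2) * cos ((u + t) \<bullet> x + (r + s)))"
    (is "_ = ?f")
  proof
    fix x
    have "u \<bullet> x + r - (t \<bullet> x + s) = (u - t) \<bullet> x + (r - s)"
         "u \<bullet> x + r + (t \<bullet> x + s) = (u + t) \<bullet> x + (r + s)"
      by (simp_all add: inner_diff_left inner_add_left)
    with cos_times_cos[of "u \<bullet> x + r" "t \<bullet> x + s"]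
    show "(d * cos (u \<bullet> x + r)) * (c * cos (t \<bullet> x + s)) = ?f x"
      by (simp add: field_simps)
  qed
  also have "?f \<in> trig_polys"
    by (intro trig_polys.intros)
  finally show ?case .
next
  case (add f g)
  have "(\<lambda>x. (f x + g x) * (c * cos (t \<bullet> x + s))) =
        (\<lambda>x. f x * (c * cos (t \<bullet> x + s)) + g x * (c * cos (t \<bullet> x + s)))"
    by (simp add: distrib_right)
  with trig_polys.add[OF add.IH] show ?case by simp
qed

lemma trig_polys_mult:
  assumes "g \<in> trig_polys" "f \<in> trig_polys"
  shows "(\<lambda>x. f x * g x) \<in> trig_polys"
  using assms
proof induction
  case (mono c t s)
  then show ?case by (intro trig_polys_mult_mono)
next
  case (add g h)
  then show ?case by (simp add: distrib_left trig_polys.add)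
qed

lemma trig_polys_continuous_bounded:
  assumes "f \<in> trig_polys"
  shows "continuous_on UNIV f \<and> (\<exists>B. \<forall>x. \<bar>f x\<bar> \<le> B)"
  using assms
proof induction
  case (mono c t s)
  have "\<bar>c * cos (t \<bullet> x + s)\<bar> \<le> \<bar>c\<bar>" for x
    using mult_left_mono[of "\<bar>cos (t \<bullet> x + s)\<bar>" 1 "\<bar>c\<bar>"] by (simp add: abs_mult)
  then show ?case by (auto intro!: continuous_intros)
next
  case (add f g)
  then obtain B C where "\<forall>x. \<bar>f x\<bar> \<le> B" "\<forall>x. \<bar>g x\<bar> \<le> C" by auto
  then have "\<bar>f x + g x\<bar> \<le> B + C" for x
    by (meson abs_triangle_ineq add_mono order_trans)
  with add.IH show ?case by (auto intro!: continuous_intros)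
qed

lemma trig_polys_dense_on_compact:
  fixes f :: "'a::euclidean_space \<Rightarrow> real"
  assumes "compact S" "continuous_on S f" "0 < e"
  shows "\<exists>g\<in>trig_polys. \<forall>x\<in>S. \<bar>f x - g x\<bar> < e"
proof -
  interpret function_ring_on trig_polys S
  proof
    show "compact S" by fact
    show "continuous_on S f" if "f \<in> trig_polys" for f :: "'a \<Rightarrow> real"
      using trig_polys_continuous_bounded[OF that] continuous_on_subset by blast
    show "\<exists>f\<in>trig_polys. f x \<noteq> f y" if "x \<noteq> y" for x y :: 'a
    proof
      \<comment> \<open>The frequency is scaled, and the phase chosen, so that the argument of the cosine
         is 1 at x and 0 at y.\<close>
      define t where "t = (1 / ((x - y) \<bullet> (x - y))) *\<^sub>R (x - y)"
      have "t \<bullet> x + - (t \<bullet> y) = ((x - y) \<bullet> x - (x - y) \<bullet> y) / ((x - y) \<bullet> (x - y))"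
        unfolding t_def by (simp add: diff_divide_distrib)
      also have "(x - y) \<bullet> x - (x - y) \<bullet> y = (x - y) \<bullet> (x - y)"
        by (simp only: inner_diff_right)
      also have "((x - y) \<bullet> (x - y)) / ((x - y) \<bullet> (x - y)) = 1" using that by simp
      finally have "t \<bullet> x + - (t \<bullet> y) = 1" .
      then show "1 * cos (t \<bullet> x + - (t \<bullet> y)) \<noteq> 1 * cos (t \<bullet> y + - (t \<bullet> y))"
        using cos_monotone_0_pi[of 0 1] pi_gt3 by simp
    qed (rule trig_polys.mono)
  qed (auto intro: trig_polys.add trig_polys_mult trig_polys_const)
  show ?thesis by (rule Stone_Weierstrass_basic) fact+
qed

lemma trig_polys_comp_polynomial:
  assumes "real_polynomial_function p" "g \<in> trig_polys"
  shows "(\<lambda>x. p (g x)) \<in> trig_polys"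
  using assms
proof (induction p)
  case (linear f)
  have "f (g x) = f 1 * g x" for x
    using linear_scale[OF bounded_linear.linear[OF linear(1)], of "g x" 1] by simp
  with trig_polys_mult[OF linear(2) trig_polys_const[of "f 1"]] show ?case by simp
qed (auto intro: trig_polys.add trig_polys_mult trig_polys_const)

lemma norm_tail_prob_small:
  fixes \<mu> :: "'b::euclidean_space measure"
  assumes "prob_space \<mu>" "sets \<mu> = sets borel" "0 < e"
  shows "\<exists>K. measure \<mu> {x. K < norm x} \<le> e"
proof -
  interpret prob_space \<mu> by fact
  note [measurable_cong] = assms(2)
  have sp: "space \<mu> = UNIV" using sets_eq_imp_space_eq[OF assms(2)] by simp
  have "(\<lambda>n. measure \<mu> {x. real n < norm x}) \<longlonglongrightarrow> measure \<mu> (\<Inter>n. {x. real n < norm x})"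
  proof (rule finite_Lim_measure_decseq)
    have "{x\<in>space \<mu>. real n < norm x} \<in> sets \<mu>" for n by measurable
    then show "range (\<lambda>n. {x. real n < norm x}) \<subseteq> sets \<mu>" by (auto simp: sp)
    show "decseq (\<lambda>n. {x. real n < norm x})" by (auto simp: decseq_def)
  qed
  also have "(\<Inter>n. {x::'b. real n < norm x}) = {}"
    using reals_Archimedean2 less_asym by (auto simp: set_eq_iff) blast
  finally have "\<forall>\<^sub>F n in sequentially. measure \<mu> {x. real n < norm x} < e"
    using \<open>0 < e\<close> by (intro order_tendstoD) auto
  then show ?thesis
    by (auto simp: eventually_sequentially intro: less_imp_le)
qed

text \<open>
  Changing the test function by at most \<open>e\<close> changes both expectations by at most \<open>e\<close>. Hence the set of
  test functions along which expectations converge is uniformly closed.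
\<close>

lemma expectation_tendsto_uniform_approx:
  fixes \<phi> :: "'b::topological_space \<Rightarrow> real"
  assumes M: "prob_space M" and \<mu>: "prob_space \<mu>" "sets \<mu> = sets borel"
    and Y[measurable]: "\<And>N. Y N \<in> borel_measurable M" and \<phi>[measurable]: "\<phi> \<in> borel_measurable borel"
    and approx: "\<And>e. 0 < e \<Longrightarrow> \<exists>g B. g \<in> borel_measurable borel \<and> (\<forall>x. \<bar>g x\<bar> \<le> B) \<and> (\<forall>x. \<bar>\<phi> x - g x\<bar> \<le> e) \<and>
        (\<lambda>N. LINT \<omega>|M. g (Y N \<omega>)) \<longlonglongrightarrow> (LINT x|\<mu>. g x)"
  shows "(\<lambda>N. LINT \<omega>|M. \<phi> (Y N \<omega>)) \<longlonglongrightarrow> (LINT x|\<mu>. \<phi> x)"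
proof (rule LIMSEQ_I)
  fix r :: real assume "0 < r"
  then obtain g B where g[measurable]: "g \<in> borel_measurable borel" and B: "\<forall>x. \<bar>g x\<bar> \<le> B"
    and g\<phi>: "\<forall>x. \<bar>\<phi> x - g x\<bar> \<le> r / 3"
    and lim: "(\<lambda>N. LINT \<omega>|M. g (Y N \<omega>)) \<longlonglongrightarrow> (LINT x|\<mu>. g x)"
    using approx[of "r / 3"] by auto
  interpret M: prob_space M by fact
  interpret \<mu>: prob_space \<mu> by fact
  note [measurable_cong] = \<mu>(2)
  have B': "\<bar>\<phi> x\<bar> \<le> B + r / 3" for x
    using B[rule_format, of x] g\<phi>[rule_format, of x] by linarith
  have 1: "\<bar>(LINT \<omega>|M. \<phi> (Y N \<omega>)) - (LINT \<omega>|M. g (Y N \<omega>))\<bar> \<le> r / 3" for N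
  proof -
    have "integrable M (\<lambda>\<omega>. \<phi> (Y N \<omega>))"
      using B' by (intro M.integrable_const_bound[where B = "B + r / 3"]) auto
    moreover have "integrable M (\<lambda>\<omega>. g (Y N \<omega>))"
      using B by (intro M.integrable_const_bound[where B = B]) auto
    ultimately show ?thesis
      using M.abs_expectation_le_off_event[of "\<lambda>\<omega>. \<phi> (Y N \<omega>) - g (Y N \<omega>)" "{}" "r / 3" "r / 3"]
        g\<phi> \<open>0 < r\<close> by simp
  qed
  have 2: "\<bar>(LINT x|\<mu>. \<phi> x) - (LINT x|\<mu>. g x)\<bar> \<le> r / 3"
  proof -
    have "integrable \<mu> (\<lambda>\<omega>. \<phi> \<omega>)"
      using B' by (intro \<mu>.integrable_const_bound[where B = "B + r / 3"]) auto
    moreover have "integrable \<mu> (\<lambda>\<omega>. g \<omega>)"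
      using B by (intro \<mu>.integrable_const_bound[where B = B]) auto
    ultimately show ?thesis
      using \<mu>.abs_expectation_le_off_event[of "\<lambda>\<omega>. \<phi> \<omega> - g \<omega>" "{}" "r / 3" "r / 3"]
        g\<phi> \<open>0 < r\<close> by simp
  qed
  have "\<exists>no. \<forall>N\<ge>no. \<bar>(LINT \<omega>|M. g (Y N \<omega>)) - (LINT x|\<mu>. g x)\<bar> < r / 3"
    using LIMSEQ_D[OF lim, of "r / 3"] \<open>0 < r\<close> by simp
  then obtain no where no: "\<And>N. N \<ge> no \<Longrightarrow> \<bar>(LINT \<omega>|M. g (Y N \<omega>)) - (LINT x|\<mu>. g x)\<bar> < r / 3"
    by blast
  show "\<exists>no. \<forall>n\<ge>no. norm ((LINT \<omega>|M. \<phi> (Y n \<omega>)) - (LINT x|\<mu>. \<phi> x)) < r"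
  proof (intro exI allI impI)
    fix n assume "no \<le> n"
    from 1[of n] 2 no[OF this] show "norm ((LINT \<omega>|M. \<phi> (Y n \<omega>)) - (LINT x|\<mu>. \<phi> x)) < r"
      unfolding real_norm_def abs_le_iff abs_less_iff by linarith
  qed
qed

text \<open>
  A form of the Cramer--Wold device. Given a bounded continuous \<open>f\<close>, the Stone--Weierstrass theorem
  approximates it by a trigonometric polynomial \<open>g\<close> on a large ball, and tightness makes the complement
  of the ball negligible, provided the approximant is bounded there independently of the ball. This
  fails for \<open>g\<close>, so \<open>g\<close> is clipped at a bound of \<open>f\<close>. The clipped function is no longer a trigonometric
  polynomial, but it is a uniform limit of polynomials in \<open>g\<close> (Weierstrass, on the bounded range of
  \<open>g\<close>), and these are trigonometric polynomials again.
\<close>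

lemma expectation_tendsto_of_cos:
  fixes Y :: "nat \<Rightarrow> 'a \<Rightarrow> 'b::euclidean_space" and f :: "'b \<Rightarrow> real"
  assumes M: "prob_space M" and \<mu>: "prob_space \<mu>" "sets \<mu> = sets borel"
    and Y[measurable]: "\<And>N. Y N \<in> borel_measurable M"
    and cos_conv: "\<And>t s. (\<lambda>N. LINT \<omega>|M. cos (t \<bullet> Y N \<omega> + s)) \<longlonglongrightarrow> (LINT x|\<mu>. cos (t \<bullet> x + s))"
    and tight: "\<And>e. 0 < e \<Longrightarrow> \<exists>K. \<forall>\<^sub>F N in sequentially. measure M {\<omega>\<in>space M. K < norm (Y N \<omega>)} \<le> e"
    and f: "continuous_on UNIV f" "bounded (range f)"
  shows "(\<lambda>N. LINT \<omega>|M. f (Y N \<omega>)) \<longlonglongrightarrow> (LINT x|\<mu>. f x)"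
proof -
  interpret M: prob_space M by fact
  interpret \<mu>: prob_space \<mu> by fact
  note [measurable_cong] = \<mu>(2)
  have sp: "space \<mu> = UNIV" using sets_eq_imp_space_eq[OF \<mu>(2)] by simp
  have trig: "(\<lambda>N. LINT \<omega>|M. g (Y N \<omega>)) \<longlonglongrightarrow> (LINT x|\<mu>. g x)" if "g \<in> trig_polys" for g
    using that
  proof induction
    case (mono c t s)
    then show ?case using tendsto_mult_left[OF cos_conv] by simp
  next
    case (add g h)
    obtain B C where BC: "\<forall>x. \<bar>g x\<bar> \<le> B" "\<forall>x. \<bar>h x\<bar> \<le> C"
      using trig_polys_continuous_bounded add.hyps by meson
    have [measurable]: "g \<in> borel_measurable borel" "h \<in> borel_measurable borel"
      using trig_polys_continuous_bounded add.hyps borel_measurable_continuous_onI by blast+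
    have "integrable M (\<lambda>\<omega>. g (Y N \<omega>))" "integrable M (\<lambda>\<omega>. h (Y N \<omega>))" for N
      using BC M.integrable_const_bound[of "\<lambda>\<omega>. g (Y N \<omega>)" B]
        M.integrable_const_bound[of "\<lambda>\<omega>. h (Y N \<omega>)" C] by simp_all
    moreover have "integrable \<mu> g" "integrable \<mu> h"
      using BC \<mu>.integrable_const_bound[of g B] \<mu>.integrable_const_bound[of h C] by simp_all
    ultimately show ?case
      using tendsto_add[OF add.IH] by simp
  qed
  have comp: "(\<lambda>N. LINT \<omega>|M. \<phi> (g (Y N \<omega>))) \<longlonglongrightarrow> (LINT x|\<mu>. \<phi> (g x))"
    if g: "g \<in> trig_polys" and \<phi>: "continuous_on UNIV \<phi>" for g and \<phi> :: "real \<Rightarrow> real"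
  proof (rule expectation_tendsto_uniform_approx[OF M \<mu> Y])
    have cg: "continuous_on UNIV g" using trig_polys_continuous_bounded[OF g] by simp
    then have "continuous_on UNIV (\<lambda>x. \<phi> (g x))"
      using continuous_on_compose2[OF \<phi> cg] by auto
    then show "(\<lambda>x. \<phi> (g x)) \<in> borel_measurable borel"
      by (rule borel_measurable_continuous_onI)
    fix e :: real assume "0 < e"
    obtain B where B: "\<And>x. \<bar>g x\<bar> \<le> B"
      using trig_polys_continuous_bounded[OF g] by blast
    obtain p where p: "real_polynomial_function p" "\<And>x. x \<in> {-B..B} \<Longrightarrow> \<bar>\<phi> x - p x\<bar> < e"
      using Stone_Weierstrass_real_polynomial_function[of "{-B..B}" \<phi> e] \<open>0 < e\<close>
        continuous_on_subset[OF \<phi>] by auto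
    have pg: "(\<lambda>x. p (g x)) \<in> trig_polys"
      by (rule trig_polys_comp_polynomial) fact+
    have "\<bar>\<phi> (g x) - p (g x)\<bar> \<le> e" for x
      using p(2)[of "g x"] B[of x] by (auto simp: abs_le_iff intro: less_imp_le)
    then show "\<exists>h C. h \<in> borel_measurable borel \<and> (\<forall>x. \<bar>h x\<bar> \<le> C) \<and> (\<forall>x. \<bar>\<phi> (g x) - h x\<bar> \<le> e) \<and>
        (\<lambda>N. LINT \<omega>|M. h (Y N \<omega>)) \<longlonglongrightarrow> (LINT x|\<mu>. h x)"
      using trig[OF pg] trig_polys_continuous_bounded[OF pg]
        borel_measurable_continuous_onI[of "\<lambda>x. p (g x)"] by blast
  qed
  obtain L where L: "\<And>x. \<bar>f x\<bar> \<le> L"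
    using f(2) unfolding bounded_iff by auto
  have "0 \<le> L" using L[of undefined] by linarith
  have [measurable]: "f \<in> borel_measurable borel"
    using f(1) by (rule borel_measurable_continuous_onI)
  define clip where "clip x = max (- L) (min L x)" for x :: real
  have clip: "\<bar>clip x\<bar> \<le> L" "\<bar>y\<bar> \<le> L \<Longrightarrow> \<bar>y - clip x\<bar> \<le> \<bar>y - x\<bar>" for x y
    using \<open>0 \<le> L\<close> by (auto simp: clip_def)
  have cont_clip: "continuous_on UNIV clip"
    unfolding clip_def by (intro continuous_intros)
  show ?thesis
  proof (rule LIMSEQ_I)
    fix r :: real assume "0 < r"
    define e where "e = r / (4 + 4 * L)"
    have "0 < e" using \<open>0 < r\<close> \<open>0 \<le> L\<close> by (simp add: e_def)
    obtain K1 where K1: "\<forall>\<^sub>F N in sequentially. measure M {\<omega>\<in>space M. K1 < norm (Y N \<omega>)} \<le> e"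
      using tight[OF \<open>0 < e\<close>] by blast
    obtain K2 where K2: "measure \<mu> {x. K2 < norm x} \<le> e"
      using norm_tail_prob_small[OF \<mu> \<open>0 < e\<close>] by blast
    define K where "K = max K1 K2"
    have [measurable]: "{x::'b. c < norm x} \<in> sets borel" for c by measurable
    have "measure \<mu> {x. K < norm x} \<le> measure \<mu> {x. K2 < norm x}"
      by (rule \<mu>.finite_measure_mono) (auto simp: K_def \<mu>(2))
    with K2 have K2': "measure \<mu> {x. K < norm x} \<le> e" by simp
    obtain g where g: "g \<in> trig_polys" "\<And>x. x \<in> cball 0 K \<Longrightarrow> \<bar>f x - g x\<bar> < e"
      using trig_polys_dense_on_compact[OF compact_cball continuous_on_subset[OF f(1)] \<open>0 < e\<close>] by blast
    define h where "h x = clip (g x)" for x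
    have [measurable]: "h \<in> borel_measurable borel"
    proof (rule borel_measurable_continuous_onI)
      have "continuous_on UNIV g" using trig_polys_continuous_bounded[OF g(1)] by simp
      then show "continuous_on UNIV h"
        unfolding h_def using continuous_on_compose2[OF cont_clip] by blast
    qed
    have fh: "\<bar>f x - h x\<bar> \<le> e" if "\<not> K < norm x" for x
      using g(2)[of x] clip(2)[OF L, of x "g x"] that by (auto simp: h_def)
    have fh': "\<bar>f x - h x\<bar> \<le> 2 * L" for x
      using clip(1)[of "g x"] L[of x] by (auto simp: h_def)
    have A: "\<bar>(LINT x|\<mu>. f x) - (LINT x|\<mu>. h x)\<bar> \<le> e + 2 * L * e"
    proof -
      have "integrable \<mu> f" "integrable \<mu> h"
        using L clip(1) by (auto intro!: \<mu>.integrable_const_bound[where B = L] simp: h_def)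
      then have "\<bar>(LINT x|\<mu>. f x) - (LINT x|\<mu>. h x)\<bar> = \<bar>LINT x|\<mu>. f x - h x\<bar>" by simp
      also have "\<dots> \<le> e + (2 * L) * measure \<mu> {x. K < norm x}"
        using fh fh' \<open>0 < e\<close> by (intro \<mu>.abs_expectation_le_off_event) (auto simp: \<mu>(2))
      also have "\<dots> \<le> e + 2 * L * e"
        using K2' \<open>0 \<le> L\<close> by (intro add_left_mono mult_left_mono) auto
      finally show ?thesis .
    qed
    have B: "\<bar>(LINT \<omega>|M. f (Y N \<omega>)) - (LINT \<omega>|M. h (Y N \<omega>))\<bar> \<le> e + 2 * L * e"
      if "measure M {\<omega>\<in>space M. K1 < norm (Y N \<omega>)} \<le> e" for N
    proof -
      have "integrable M (\<lambda>\<omega>. f (Y N \<omega>))" "integrable M (\<lambda>\<omega>. h (Y N \<omega>))"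
        using L clip(1) by (auto intro!: M.integrable_const_bound[where B = L] simp: h_def[symmetric])
          (auto simp: h_def)
      then have "\<bar>(LINT \<omega>|M. f (Y N \<omega>)) - (LINT \<omega>|M. h (Y N \<omega>))\<bar> = \<bar>LINT \<omega>|M. f (Y N \<omega>) - h (Y N \<omega>)\<bar>" by simp
      also have "\<dots> \<le> e + (2 * L) * measure M {\<omega>\<in>space M. K < norm (Y N \<omega>)}"
        using fh fh' \<open>0 < e\<close> by (intro M.abs_expectation_le_off_event) auto
      also have "\<dots> \<le> e + (2 * L) * measure M {\<omega>\<in>space M. K1 < norm (Y N \<omega>)}"
        using \<open>0 \<le> L\<close> by (intro add_left_mono mult_left_mono M.finite_measure_mono) (auto simp: K_def)
      also have "\<dots> \<le> e + 2 * L * e"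
        using that \<open>0 \<le> L\<close> by (intro add_left_mono mult_left_mono) auto
      finally show ?thesis .
    qed
    have C: "\<forall>\<^sub>F N in sequentially. \<bar>(LINT \<omega>|M. h (Y N \<omega>)) - (LINT x|\<mu>. h x)\<bar> < e"
      using tendstoD[OF comp[OF g(1) cont_clip] \<open>0 < e\<close>] by (simp add: h_def dist_real_def)
    have "\<forall>\<^sub>F N in sequentially. \<bar>(LINT \<omega>|M. f (Y N \<omega>)) - (LINT x|\<mu>. f x)\<bar> < r"
      using C K1
    proof eventually_elim
      case (elim N)
      have "e * (4 + 4 * L) = r"
        using \<open>0 \<le> L\<close> by (simp add: e_def)
      then have "3 * e + 4 * L * e \<le> r"
        using \<open>0 < e\<close> by (simp add: algebra_simps)
      with A B[OF elim(2)] elim(1) \<open>0 < e\<close> show ?case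
        unfolding abs_le_iff abs_less_iff by linarith
    qed
    then show "\<exists>no. \<forall>n\<ge>no. norm ((LINT \<omega>|M. f (Y n \<omega>)) - (LINT x|\<mu>. f x)) < r"
      by (simp add: eventually_sequentially)
  qed
qed

section \<open>Centered normal laws with a given covariance matrix\<close>

definition outer_square :: "real ^ 'd \<Rightarrow> real ^ 'd ^ 'd" where
  "outer_square w = (\<chi> i j. w $ i * w $ j)"

lemma outer_square_mult_vec: "outer_square w *v a = (w \<bullet> a) *\<^sub>R w"
  by (simp add: outer_square_def vec_eq_iff matrix_vector_mult_def inner_vec_def sum_distrib_right
      sum_distrib_left mult_ac)

lemma inner_symmetric_matrix:
  fixes S :: "real ^ 'd ^ 'd"
  assumes "transpose S = S"
  shows "x \<bullet> (S *v y) = y \<bullet> (S *v x)"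
  by (metis assms dot_lmul_matrix inner_commute vector_transpose_matrix)

lemma matrix_vector_mult_axis: "(S *v axis l 1) $ i = (S::real ^ 'd ^ 'd) $ i $ l"
  by (simp add: matrix_vector_mult_basis column_def)

text \<open>
  Symmetric Gaussian elimination, one index at a time. If the pivot \<open>S $ l $ l\<close> is positive, the outer
  square of the \<open>l\<close>-th row divided by the square root of the pivot is split off; this clears the row
  and the column \<open>l\<close>, and completing the square shows that the rest is still positive semidefinite. If
  the pivot is zero, semidefiniteness forces the whole row to vanish, and there is nothing to split off.
\<close>

lemma psd_eq_sum_outer_squares:
  fixes S :: "real ^ 'd ^ 'd"
  assumes "finite J" and "transpose S = S" and "\<And>a. 0 \<le> a \<bullet> (S *v a)"
    and "\<And>i j. i \<notin> J \<Longrightarrow> S $ i $ j = 0"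
  shows "\<exists>v. S = (\<Sum>l\<in>J. outer_square (v l))"
  using assms
proof (induction J arbitrary: S rule: finite_induct)
  case empty
  then show ?case by (auto simp: vec_eq_iff)
next
  case (insert l J)
  note sym = insert.prems(1) and psd = insert.prems(2) and supp = insert.prems(3)
  have sym': "S $ i $ j = S $ j $ i" for i j
    using sym by (metis transpose_def vec_lambda_beta)
  define q where "q = S $ l $ l"
  have q: "q = axis l 1 \<bullet> (S *v axis l 1)"
    by (simp add: inner_axis' matrix_vector_mult_axis q_def)
  have row: "(S *v a) $ l = a \<bullet> (S *v axis l 1)" for a
    using inner_symmetric_matrix[OF sym, of a "axis l 1"] by (simp add: inner_axis')
  have expand: "(a - c *\<^sub>R axis l 1) \<bullet> (S *v (a - c *\<^sub>R axis l 1)) =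
      a \<bullet> (S *v a) - 2 * c * (S *v a) $ l + c\<^sup>2 * q" for a c
    by (simp add: matrix_vector_mult_diff_distrib matrix_vector_mult_scaleR inner_diff_left
        inner_diff_right row[symmetric] inner_axis' matrix_vector_mult_axis power2_eq_square
        algebra_simps flip: q_def)
  have "0 \<le> q" using psd q by simp
  show ?case
  proof (cases "q = 0")
    case True
    have zero: "S $ l $ j = 0" for j
    proof (rule ccontr)
      assume "S $ l $ j \<noteq> 0"
      \<comment> \<open>With a zero pivot the form at e_j - c e_l is affine in c; the
         coefficient used below gives it the value -1.\<close>
      define p where "p = axis j 1 \<bullet> (S *v axis j 1)"
      have "0 \<le> p - 2 * ((p + 1) / (2 * S $ l $ j)) * S $ l $ j"
        using psd[of "axis j 1 - ((p + 1) / (2 * S $ l $ j)) *\<^sub>R axis l 1"]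
        unfolding expand by (simp add: True p_def matrix_vector_mult_axis)
      then show False using \<open>S $ l $ j \<noteq> 0\<close> by simp
    qed
    have "\<exists>v. S = (\<Sum>l\<in>J. outer_square (v l))"
      using zero supp by (intro insert.IH sym psd) (metis insertE)
    then obtain v where "S = (\<Sum>l\<in>J. outer_square (v l))" by blast
    also have "\<dots> = (\<Sum>m\<in>insert l J. outer_square ((v(l := 0)) m))"
      using insert.hyps by (auto simp: outer_square_def vec_eq_iff intro!: sum.cong)
    finally show ?thesis by blast
  next
    case False
    with \<open>0 \<le> q\<close> have "0 < q" by simp
    define w where "w = (\<chi> i. S $ l $ i / sqrt q)"
    have wa: "w \<bullet> a = (S *v a) $ l / sqrt q" for a
      by (simp add: w_def inner_vec_def matrix_vector_mult_def sum_divide_distrib)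
    have "\<exists>v. S - outer_square w = (\<Sum>l\<in>J. outer_square (v l))"
    proof (rule insert.IH)
      show "transpose (S - outer_square w) = S - outer_square w"
        by (simp add: transpose_def outer_square_def vec_eq_iff sym' mult.commute)
      show "0 \<le> a \<bullet> ((S - outer_square w) *v a)" for a
      proof -
        have "a \<bullet> ((S - outer_square w) *v a) = a \<bullet> (S *v a) - (w \<bullet> a)\<^sup>2"
          by (simp add: matrix_vector_mult_diff_rdistrib outer_square_mult_vec inner_diff_right
              inner_commute power2_eq_square)
        also have "\<dots> = (a - ((S *v a) $ l / q) *\<^sub>R axis l 1) \<bullet> (S *v (a - ((S *v a) $ l / q) *\<^sub>R axis l 1))"
          unfolding expand using \<open>0 < q\<close> by (simp add: wa power_divide field_simps power2_eq_square)
        finally show ?thesis using psd by simp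
      qed
      show "(S - outer_square w) $ i $ j = 0" if "i \<notin> J" for i j
      proof (cases "i = l")
        case True
        then show ?thesis
          using \<open>0 < q\<close> by (simp add: outer_square_def w_def flip: q_def)
      next
        case False
        with that supp have "S $ i $ m = 0" for m by blast
        then show ?thesis by (simp add: outer_square_def w_def sym'[of l i])
      qed
    qed
    then obtain v where "S - outer_square w = (\<Sum>l\<in>J. outer_square (v l))" by blast
    then have "S = outer_square w + (\<Sum>l\<in>J. outer_square (v l))"
      by (simp add: algebra_simps)
    also have "\<dots> = (\<Sum>m\<in>insert l J. outer_square ((v(l := w)) m))"
    proof -
      have "(\<Sum>l\<in>J. outer_square (v l)) = (\<Sum>m\<in>J. outer_square ((v(l := w)) m))"
        using insert.hyps by (intro sum.cong) auto
      then show ?thesis using insert.hyps by simp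
    qed
    finally show ?thesis by blast
  qed
qed

lemma distributed_weighted_sum_std_normals:
  fixes c :: "'d::finite \<Rightarrow> real"
  defines "P \<equiv> \<Pi>\<^sub>M i\<in>(UNIV :: 'd set). std_normal_distribution"
  assumes "\<exists>i. c i \<noteq> 0"
  shows "distributed P lborel (\<lambda>z. \<Sum>i\<in>UNIV. c i * z i) (normal_density 0 (sqrt (\<Sum>i\<in>UNIV. (c i)\<^sup>2)))"
proof -
  interpret N: prob_space std_normal_distribution
    using real_dist_normal_dist by (simp add: real_distribution_def)
  have prob_P: "prob_space P"
    unfolding P_def by (intro prob_space_PiM) unfold_locales
  interpret P: prob_space P by fact
  have comp: "distr P std_normal_distribution (\<lambda>z. z i) = std_normal_distribution" for i
    unfolding P_def by (intro distr_PiM_component UNIV_I) unfold_locales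
  have rv [measurable]: "(\<lambda>z. z i) \<in> measurable P std_normal_distribution" for i
    unfolding P_def by simp
  have "P.indep_vars (\<lambda>_. std_normal_distribution) (\<lambda>i z. z i) UNIV"
  proof (subst P.indep_vars_iff_distr_eq_PiM')
    have "distr P (PiM UNIV (\<lambda>_. std_normal_distribution)) (\<lambda>x. \<lambda>i\<in>UNIV. x i) = distr P P (\<lambda>x. x)"
      by (intro distr_cong) (auto simp: P_def)
    then show "distr P (PiM UNIV (\<lambda>_. std_normal_distribution)) (\<lambda>x. \<lambda>i\<in>UNIV. x i) =
        PiM UNIV (\<lambda>i. distr P std_normal_distribution (\<lambda>x. x i))"
      unfolding comp by (simp add: P_def)
  qed (use rv in auto)
  then have indep: "P.indep_vars (\<lambda>_. borel) (\<lambda>i z. c i * z i) UNIV"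
    by (rule P.indep_vars_compose2[where X = "\<lambda>i z. z i" and Y = "\<lambda>i x. c i * x"]) auto
  have std: "distributed P lborel (\<lambda>z. z i) std_normal_density" for i
  proof -
    have "distr P lborel (\<lambda>z. z i) = distr P std_normal_distribution (\<lambda>z. z i)"
      by (intro distr_cong) auto
    then show ?thesis
      using rv[of i] by (simp add: distributed_def comp)
  qed
  \<comment> \<open>Summands with weight zero have no density and are left out.\<close>
  define I where "I = {i. c i \<noteq> 0}"
  have "distributed P lborel (\<lambda>z. \<Sum>i\<in>I. c i * z i) (normal_density (\<Sum>i\<in>I. 0) (sqrt (\<Sum>i\<in>I. \<bar>c i\<bar>\<^sup>2)))"
  proof (rule P.sum_indep_normal)
    show "P.indep_vars (\<lambda>_. borel) (\<lambda>i z. c i * z i) I"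
      using indep by (rule P.indep_vars_subset) simp
    show "distributed P lborel (\<lambda>z. c i * z i) (normal_density 0 \<bar>c i\<bar>)" if "i \<in> I" for i
      using P.normal_density_affine[OF std[of i], of "c i" 0] that by (simp add: I_def)
  qed (use assms(2) in \<open>auto simp: I_def\<close>)
  moreover have "(\<Sum>i\<in>I. c i * z i) = (\<Sum>i\<in>UNIV. c i * z i)" for z
    by (intro sum.mono_neutral_left) (auto simp: I_def)
  moreover have "(\<Sum>i\<in>I. \<bar>c i\<bar>\<^sup>2) = (\<Sum>i\<in>UNIV. (c i)\<^sup>2)"
    unfolding power2_abs by (intro sum.mono_neutral_left) (auto simp: I_def)
  ultimately show ?thesis by simp
qed

text \<open>
  If \<open>S\<close> is the sum of the outer squares of vectors \<open>v l\<close>, then the random combination of the \<open>v l\<close> with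
  independent standard normal coefficients has covariance matrix \<open>S\<close>, whether or not \<open>S\<close> is singular.
\<close>

lemma centered_normal_exists:
  fixes S :: "real ^ 'd ^ 'd"
  assumes "transpose S = S" "\<And>a. 0 \<le> a \<bullet> (S *v a)"
  shows "\<exists>\<mu>. is_centered_normal \<mu> S"
proof -
  obtain v :: "'d \<Rightarrow> real ^ 'd" where v: "S = (\<Sum>l\<in>UNIV. outer_square (v l))"
    using psd_eq_sum_outer_squares[OF finite_class.finite_UNIV assms] by auto
  have quad: "a \<bullet> (S *v a) = (\<Sum>l\<in>UNIV. (v l \<bullet> a)\<^sup>2)" for a
  proof -
    have "(\<Sum>l\<in>J. outer_square (v l)) *v a = (\<Sum>l\<in>J. (v l \<bullet> a) *\<^sub>R v l)" for J
      by (induction J rule: infinite_finite_induct)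
         (auto simp: matrix_vector_mult_add_rdistrib outer_square_mult_vec)
    then show ?thesis
      by (simp add: v inner_sum_right inner_commute power2_eq_square)
  qed
  interpret N: prob_space std_normal_distribution
    using real_dist_normal_dist by (simp add: real_distribution_def)
  define P where "P = (\<Pi>\<^sub>M i\<in>(UNIV :: 'd set). std_normal_distribution)"
  interpret P: prob_space P
    unfolding P_def by (intro prob_space_PiM) unfold_locales
  define \<mu> where "\<mu> = distr P borel (\<lambda>z. \<Sum>l\<in>UNIV. z l *\<^sub>R v l)"
  have [measurable]: "(\<lambda>z. z i) \<in> borel_measurable P" for i
  proof -
    have "(\<lambda>z. z i) \<in> measurable P std_normal_distribution" unfolding P_def by simp
    then show ?thesis by simp
  qed
  have "is_centered_normal \<mu> S"
    unfolding is_centered_normal_def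
  proof (intro conjI allI)
    show "sets \<mu> = sets borel" by (simp add: \<mu>_def)
    fix a :: "real ^ 'd"
    have 1: "distr \<mu> borel (\<lambda>x. a \<bullet> x) = distr P borel (\<lambda>z. \<Sum>l\<in>UNIV. (v l \<bullet> a) * z l)"
      unfolding \<mu>_def by (subst distr_distr) (auto simp: inner_sum_right o_def mult_ac inner_commute intro!: distr_cong)
    show "distr \<mu> borel (\<lambda>x. a \<bullet> x) =
         (if a \<bullet> (S *v a) = 0 then return borel 0
          else density lborel (\<lambda>t. ennreal (normal_density 0 (sqrt (a \<bullet> (S *v a))) t)))"
    proof (cases "\<exists>l. v l \<bullet> a \<noteq> 0")
      case True
      then have "distributed P lborel (\<lambda>z. \<Sum>l\<in>UNIV. (v l \<bullet> a) * z l)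
          (normal_density 0 (sqrt (a \<bullet> (S *v a))))"
        unfolding quad P_def by (rule distributed_weighted_sum_std_normals)
      moreover have "distr P borel f = distr P lborel f" for f :: "_ \<Rightarrow> real"
        by (intro distr_cong) auto
      moreover have "a \<bullet> (S *v a) \<noteq> 0"
        unfolding quad using True by (subst sum_nonneg_eq_0_iff) auto
      ultimately show ?thesis
        unfolding 1 by (simp add: distributed_def)
    next
      case False
      then have "distr \<mu> borel (\<lambda>x. a \<bullet> x) = return borel 0"
        unfolding 1 by (simp add: P.distr_const)
      with False show ?thesis by (simp add: quad)
    qed
  qed (use assms in auto)
  then show ?thesis by blast
qed

section \<open>The central limit theorem for linear functionals\<close>

text \<open>
  Indexed by the variance: the one-dimensional projections in \<^const>\<open>is_centered_normal\<close>.
\<close>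

definition normal_law :: "real \<Rightarrow> real measure" where
  "normal_law v = (if v = 0 then return borel 0 else density lborel (\<lambda>t. ennreal (normal_density 0 (sqrt v) t)))"

lemma (in prob_space) indep_sum_second_moment:
  fixes W :: "nat \<Rightarrow> 'a \<Rightarrow> real"
  assumes indep: "indep_vars (\<lambda>_. borel) W UNIV"
    and mean: "\<And>n. expectation (W n) = 0"
    and sq: "\<And>n. integrable M (\<lambda>\<omega>. (W n \<omega>)\<^sup>2)"
    and var: "\<And>n. expectation (\<lambda>\<omega>. (W n \<omega>)\<^sup>2) = v"
  shows "integrable M (\<lambda>\<omega>. (\<Sum>n<N. W n \<omega>)\<^sup>2) \<and> expectation (\<lambda>\<omega>. (\<Sum>n<N. W n \<omega>)\<^sup>2) = N * v"
proof (induction N)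
  case (Suc N)
  have [measurable]: "random_variable borel (W n)" for n
    using indep unfolding indep_vars_def2 by simp
  have W: "integrable M (W n)" for n
    by (rule square_integrable_imp_integrable[OF _ sq]) simp_all
  let ?S = "\<lambda>\<omega>. \<Sum>n<N. W n \<omega>"
  have S: "integrable M ?S" using W by simp
  have "indep_vars (\<lambda>_. borel) W (insert N {..<N})"
    using indep by (rule indep_vars_subset) simp
  then have ind: "indep_var borel (W N) borel ?S"
    by (intro indep_vars_sum) auto
  have cross: "integrable M (\<lambda>\<omega>. W N \<omega> * ?S \<omega>)" "expectation (\<lambda>\<omega>. W N \<omega> * ?S \<omega>) = 0"
    using indep_var_integrable[OF ind W S] indep_var_lebesgue_integral[OF ind W S] mean by simp_all
  have "(\<Sum>n<Suc N. W n \<omega>)\<^sup>2 = (?S \<omega>)\<^sup>2 + 2 * (W N \<omega> * ?S \<omega>) + (W N \<omega>)\<^sup>2" for \<omega>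
    by (simp add: power2_sum algebra_simps)
  then show ?case
    using Suc cross sq var by (simp add: algebra_simps)
qed (simp add: prob_space)

lemma integral_cos_normal_law:
  assumes "0 < v"
  shows "(LINT x|std_normal_distribution. cos (sqrt v * x + s)) = (LINT x|normal_law v. cos (x + s))"
proof -
  interpret prob_space std_normal_distribution
    using real_dist_normal_dist by (simp add: real_distribution_def)
  have "distr std_normal_distribution lborel (\<lambda>x. x) = std_normal_distribution"
    by (rule distr_id2) simp
  then have "distributed std_normal_distribution lborel (\<lambda>x. x) std_normal_density"
    by (simp add: distributed_def)
  from normal_density_affine[OF this, of "sqrt v" 0] assms
  have "normal_law v = distr std_normal_distribution lborel (\<lambda>x. sqrt v * x)"
    by (simp add: distributed_def normal_law_def)
  then show ?thesis by (simp add: integral_distr)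
qed

text \<open>
  The one-dimensional central limit theorem, tested on cosines only and extended to variance zero,
  where all summands vanish almost surely. The degenerate case does occur below: a projection of a
  random vector with singular covariance matrix may be constant.
\<close>

lemma (in prob_space) central_limit_cos:
  fixes W :: "nat \<Rightarrow> 'a \<Rightarrow> real"
  assumes indep: "indep_vars (\<lambda>_. borel) W UNIV"
    and mean: "\<And>n. expectation (W n) = 0"
    and sq: "\<And>n. integrable M (\<lambda>\<omega>. (W n \<omega>)\<^sup>2)"
    and var: "\<And>n. expectation (\<lambda>\<omega>. (W n \<omega>)\<^sup>2) = v"
    and ident: "\<And>n. distr M borel (W n) = \<nu>"
  shows "(\<lambda>N. expectation (\<lambda>\<omega>. cos ((\<Sum>n<N. W n \<omega>) / sqrt N + s))) \<longlonglongrightarrow> (LINT x|normal_law v. cos (x + s))"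
proof (cases "v = 0")
  have [measurable]: "random_variable borel (W n)" for n
    using indep unfolding indep_vars_def2 by simp
  {
    case True
    have "AE \<omega> in M. (W n \<omega>)\<^sup>2 = 0" for n
      using integral_nonneg_eq_0_iff_AE[OF sq] var True by simp
    then have "AE \<omega> in M. \<forall>n. W n \<omega> = 0"
      by (simp add: AE_all_countable)
    then have "expectation (\<lambda>\<omega>. cos ((\<Sum>n<N. W n \<omega>) / sqrt N + s)) = expectation (\<lambda>\<omega>. cos s)" for N
      by (intro integral_cong_AE) auto
    then show ?thesis
      by (simp add: True normal_law_def prob_space integral_return)
  next
    case False
    have "0 \<le> v" unfolding var[of 0, symmetric] by simp
    with False have "0 < v" by simp
    have wc: "weak_conv_m (\<lambda>N. distr M borel (\<lambda>\<omega>. (\<Sum>n<N. W n \<omega>) / sqrt (N * (sqrt v)\<^sup>2))) std_normal_distribution"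
      using \<open>0 < v\<close> by (intro central_limit_theorem_zero_mean[OF indep mean _ sq _ ident]) (simp_all add: mean var)
    have rd: "real_distribution (distr M borel (\<lambda>\<omega>. (\<Sum>n<N. W n \<omega>) / sqrt (N * (sqrt v)\<^sup>2)))" for N
      by (intro real_distribution_distr) simp
    have "(\<lambda>N. LINT x|distr M borel (\<lambda>\<omega>. (\<Sum>n<N. W n \<omega>) / sqrt (N * (sqrt v)\<^sup>2)). cos (sqrt v * x + s)) \<longlonglongrightarrow>
        (LINT x|std_normal_distribution. cos (sqrt v * x + s))"
      by (rule weak_conv_imp_integral_bdd_continuous_conv[OF rd real_dist_normal_dist wc, where B = 1])
         (auto intro!: continuous_intros)
    also have "(\<lambda>N. LINT x|distr M borel (\<lambda>\<omega>. (\<Sum>n<N. W n \<omega>) / sqrt (N * (sqrt v)\<^sup>2)). cos (sqrt v * x + s)) =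
        (\<lambda>N. expectation (\<lambda>\<omega>. cos ((\<Sum>n<N. W n \<omega>) / sqrt N + s)))"
      using \<open>0 < v\<close> by (simp add: integral_distr real_sqrt_mult)
    finally show ?thesis
      using integral_cos_normal_law[OF \<open>0 < v\<close>] by simp
  }
qed

lemma measurable_vec_nth [measurable (raw)]:
  fixes f :: "'a \<Rightarrow> real ^ 'n"
  shows "f \<in> borel_measurable M \<Longrightarrow> (\<lambda>x. f x $ i) \<in> borel_measurable M"
proof -
  have "(\<lambda>x :: real ^ 'n. x $ i) \<in> borel_measurable borel"
    by (intro borel_measurable_continuous_onI continuous_intros)
  then show "f \<in> borel_measurable M \<Longrightarrow> (\<lambda>x. f x $ i) \<in> borel_measurable M"
    by (rule measurable_compose[rotated])
qed

lemma measurable_vec_lambda: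
  fixes f :: "'a \<Rightarrow> real ^ 'n"
  assumes "\<And>i. (\<lambda>x. f x $ i) \<in> borel_measurable M"
  shows "f \<in> borel_measurable M"
  using assms by (subst borel_measurable_euclidean_space) (auto simp: Basis_vec_def inner_axis)

lemma integrable_vec:
  fixes f :: "'a \<Rightarrow> real ^ 'n"
  assumes "\<And>i. integrable M (\<lambda>x. f x $ i)"
  shows "integrable M f"
proof -
  have "f x = (\<Sum>i\<in>UNIV. (f x $ i) *\<^sub>R axis i 1)" for x
    using basis_expansion[of "f x"] by (simp only: scalar_mult_eq_scaleR)
  then have "integrable M f \<longleftrightarrow> integrable M (\<lambda>x. \<Sum>i\<in>UNIV. (f x $ i) *\<^sub>R (axis i 1 :: real ^ 'n))"
    by (intro Bochner_Integration.integrable_cong refl)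
  moreover have "integrable M (\<lambda>x. \<Sum>i\<in>UNIV. (f x $ i) *\<^sub>R (axis i 1 :: real ^ 'n))"
    using assms by (intro Bochner_Integration.integrable_sum integrable_scaleR_left) auto
  ultimately show ?thesis by simp
qed

lemma integral_vec_nth:
  fixes f :: "'a \<Rightarrow> real ^ 'n"
  assumes "integrable M f"
  shows "(LINT x|M. f x) $ i = (LINT x|M. f x $ i)"
  using integral_bounded_linear[OF bounded_linear_vec_nth assms, of i] by simp

locale iid_centered = prob_space M for M :: "'a measure" +
  fixes U :: "nat \<Rightarrow> 'a \<Rightarrow> real ^ 'm" and V :: "real ^ 'm ^ 'm"
  assumes indep: "indep_vars (\<lambda>_. borel) U UNIV"
    and ident: "distr M borel (U n) = distr M borel (U 0)"
    and centered: "expectation (\<lambda>\<omega>. U n \<omega> $ i) = 0"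
    and square_integrable: "integrable M (\<lambda>\<omega>. (U n \<omega> $ i)\<^sup>2)"
    and covariance: "expectation (\<lambda>\<omega>. U n \<omega> $ i * U n \<omega> $ j) = V $ i $ j"
begin

definition scaled_sum :: "nat \<Rightarrow> 'a \<Rightarrow> real ^ 'm" where
  "scaled_sum N \<omega> = (1 / sqrt N) *\<^sub>R (\<Sum>n<N. U n \<omega>)"

lemma measurable_U [measurable]: "U n \<in> borel_measurable M"
  using indep unfolding indep_vars_def2 by simp

lemma measurable_scaled_sum [measurable]: "scaled_sum N \<in> borel_measurable M"
  unfolding scaled_sum_def by measurable

lemma integrable_component: "integrable M (\<lambda>\<omega>. U n \<omega> $ i)"
  by (rule square_integrable_imp_integrable[OF _ square_integrable]) simp_all

lemma integrable_component_mult: "integrable M (\<lambda>\<omega>. U n \<omega> $ i * U n \<omega> $ j)"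
proof (rule Bochner_Integration.integrable_bound)
  show "integrable M (\<lambda>\<omega>. (U n \<omega> $ i)\<^sup>2 + (U n \<omega> $ j)\<^sup>2)"
    using square_integrable by simp
  have "\<bar>x * y\<bar> \<le> x\<^sup>2 + y\<^sup>2" for x y :: real
    using sum_squares_bound[of "\<bar>x\<bar>" "\<bar>y\<bar>"] mult_nonneg_nonneg[of "\<bar>x\<bar>" "\<bar>y\<bar>"]
    unfolding abs_mult power2_abs by linarith
  then show "AE \<omega> in M. norm (U n \<omega> $ i * U n \<omega> $ j) \<le> norm ((U n \<omega> $ i)\<^sup>2 + (U n \<omega> $ j)\<^sup>2)"
    by simp
qed simp

lemma projection_moments:
  shows "indep_vars (\<lambda>_. borel) (\<lambda>n \<omega>. c \<bullet> U n \<omega>) UNIV"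
    and "distr M borel (\<lambda>\<omega>. c \<bullet> U n \<omega>) = distr M borel (\<lambda>\<omega>. c \<bullet> U 0 \<omega>)"
    and "expectation (\<lambda>\<omega>. c \<bullet> U n \<omega>) = 0"
    and "integrable M (\<lambda>\<omega>. (c \<bullet> U n \<omega>)\<^sup>2)"
    and "expectation (\<lambda>\<omega>. (c \<bullet> U n \<omega>)\<^sup>2) = c \<bullet> (V *v c)"
proof -
  show "indep_vars (\<lambda>_. borel) (\<lambda>n \<omega>. c \<bullet> U n \<omega>) UNIV"
    by (rule indep_vars_compose2[OF indep, where Y = "\<lambda>_ x. c \<bullet> x"]) simp
  have "distr M borel (\<lambda>\<omega>. c \<bullet> U k \<omega>) = distr (distr M borel (U k)) borel (\<lambda>x. c \<bullet> x)" for k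
    by (subst distr_distr) (auto simp: o_def)
  then show "distr M borel (\<lambda>\<omega>. c \<bullet> U n \<omega>) = distr M borel (\<lambda>\<omega>. c \<bullet> U 0 \<omega>)"
    by (simp only: ident[of n])
  show "expectation (\<lambda>\<omega>. c \<bullet> U n \<omega>) = 0"
    by (simp add: inner_vec_def integrable_component centered)
  have sq: "(c \<bullet> U n \<omega>)\<^sup>2 = (\<Sum>i\<in>UNIV. \<Sum>j\<in>UNIV. c $ i * c $ j * (U n \<omega> $ i * U n \<omega> $ j))" for \<omega>
    by (simp add: inner_vec_def power2_eq_square sum_product mult_ac)
  show "integrable M (\<lambda>\<omega>. (c \<bullet> U n \<omega>)\<^sup>2)"
    unfolding sq by (intro Bochner_Integration.integrable_sum integrable_mult_right integrable_component_mult)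
  have "expectation (\<lambda>\<omega>. (c \<bullet> U n \<omega>)\<^sup>2) = (\<Sum>i\<in>UNIV. \<Sum>j\<in>UNIV. c $ i * c $ j * V $ i $ j)"
    unfolding sq
    by (simp add: integrable_component_mult covariance)
  also have "\<dots> = c \<bullet> (V *v c)"
    by (simp add: inner_vec_def matrix_vector_mult_def sum_distrib_left mult_ac)
  finally show "expectation (\<lambda>\<omega>. (c \<bullet> U n \<omega>)\<^sup>2) = c \<bullet> (V *v c)" .
qed

lemma inner_scaled_sum: "c \<bullet> scaled_sum N \<omega> = (\<Sum>n<N. c \<bullet> U n \<omega>) / sqrt N"
  by (simp add: scaled_sum_def inner_sum_right)

text \<open>
  The projection of a normalised vector sum to the line spanned by \<open>c\<close> is a normalised sum of real
  random variables, so that the one-dimensional central limit theorem gives its limit.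
\<close>

lemma scaled_sum_cos_tendsto:
  "(\<lambda>N. expectation (\<lambda>\<omega>. cos (c \<bullet> scaled_sum N \<omega> + s))) \<longlonglongrightarrow>
     (LINT x|normal_law (c \<bullet> (V *v c)). cos (x + s))"
  unfolding inner_scaled_sum
  by (rule central_limit_cos[OF projection_moments(1,3,4,5,2)])

lemma quadratic_form_nonneg: "0 \<le> c \<bullet> (V *v c)"
  unfolding projection_moments(5)[of c 0, symmetric] by simp

lemma covariance_symmetric: "transpose V = V"
  by (simp add: transpose_def vec_eq_iff mult.commute flip: covariance[of 0])

text \<open>
  The factor \<open>1 / sqrt N\<close> keeps the second moments of the components at the constants \<open>V $ i $ i\<close>, so
  Markov's inequality bounds the tails uniformly in \<open>N\<close>.
\<close>

lemma scaled_sum_tight: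
  assumes "0 < e"
  shows "\<exists>K>0. \<forall>N. prob {\<omega>\<in>space M. K < norm (scaled_sum N \<omega>)} \<le> e"
proof -
  define C where "C = (\<Sum>i\<in>UNIV. V $ i $ i)"
  have Vii: "axis i 1 \<bullet> (V *v axis i 1) = V $ i $ i" for i
    by (simp add: inner_axis' matrix_vector_mult_axis)
  have nonneg: "0 \<le> V $ i $ i" for i
    using quadratic_form_nonneg[of "axis i 1"] by (simp add: Vii)
  have "0 \<le> C" unfolding C_def by (intro sum_nonneg nonneg)
  have comp: "integrable M (\<lambda>\<omega>. (scaled_sum N \<omega> $ i)\<^sup>2)"
    "expectation (\<lambda>\<omega>. (scaled_sum N \<omega> $ i)\<^sup>2) \<le> V $ i $ i" for N i
  proof -
    have eq: "(scaled_sum N \<omega> $ i)\<^sup>2 = (1 / N) * (\<Sum>n<N. axis i 1 \<bullet> U n \<omega>)\<^sup>2" for \<omega>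
      using inner_scaled_sum[of "axis i 1" N \<omega>] by (simp add: inner_axis' power_divide)
    note * = indep_sum_second_moment[OF projection_moments(1,3,4,5), of "axis i 1" N]
    show "integrable M (\<lambda>\<omega>. (scaled_sum N \<omega> $ i)\<^sup>2)"
      unfolding eq using * by (intro integrable_mult_right) simp
    have "expectation (\<lambda>\<omega>. (scaled_sum N \<omega> $ i)\<^sup>2) = (1 / N) * (N * (V $ i $ i))"
      unfolding eq using * by (simp add: Vii)
    also have "\<dots> \<le> V $ i $ i" using nonneg by (cases "N = 0") auto
    finally show "expectation (\<lambda>\<omega>. (scaled_sum N \<omega> $ i)\<^sup>2) \<le> V $ i $ i" .
  qed
  have norm_sq: "(norm (scaled_sum N \<omega>))\<^sup>2 = (\<Sum>i\<in>UNIV. (scaled_sum N \<omega> $ i)\<^sup>2)" for N \<omega>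
    by (simp add: norm_vec_def L2_set_def sum_nonneg)
  have int: "integrable M (\<lambda>\<omega>. (norm (scaled_sum N \<omega>))\<^sup>2)" for N
    unfolding norm_sq by (intro Bochner_Integration.integrable_sum comp)
  have le: "expectation (\<lambda>\<omega>. (norm (scaled_sum N \<omega>))\<^sup>2) \<le> C" for N
    unfolding norm_sq C_def by (simp add: comp(1)) (intro sum_mono comp(2))
  define K where "K = sqrt ((C + 1) / e)"
  have "0 < K" "K\<^sup>2 = (C + 1) / e"
    using \<open>0 \<le> C\<close> \<open>0 < e\<close> by (simp_all add: K_def)
  moreover have "prob {\<omega>\<in>space M. K < norm (scaled_sum N \<omega>)} \<le> e" for N
  proof -
    have "prob {\<omega>\<in>space M. K < norm (scaled_sum N \<omega>)} \<le> prob {\<omega>\<in>space M. K\<^sup>2 \<le> (norm (scaled_sum N \<omega>))\<^sup>2}"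
      using \<open>0 < K\<close> by (intro finite_measure_mono) (auto intro!: power_mono)
    also have "\<dots> \<le> expectation (\<lambda>\<omega>. (norm (scaled_sum N \<omega>))\<^sup>2) / K\<^sup>2"
      using \<open>0 < K\<close> by (intro integral_Markov_inequality_measure[OF int, of "{}"]) auto
    also have "\<dots> \<le> C / K\<^sup>2"
      using le by (intro divide_right_mono) auto
    also have "\<dots> \<le> e"
      using \<open>0 \<le> C\<close> \<open>0 < e\<close> unfolding \<open>K\<^sup>2 = (C + 1) / e\<close> by (simp add: field_simps)
    finally show ?thesis .
  qed
  ultimately show ?thesis by blast
qed

end

section \<open>The delta method\<close>

lemma abs_cos_diff_le: "\<bar>cos a - cos b\<bar> \<le> \<bar>a - b :: real\<bar>"
proof -
  have "\<bar>cos a - cos b\<bar> = 2 * (\<bar>sin ((a + b) / 2)\<bar> * \<bar>sin ((b - a) / 2)\<bar>)"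
    by (simp add: cos_diff_cos abs_mult)
  also have "\<dots> \<le> 2 * (1 * \<bar>(b - a) / 2\<bar>)"
    by (intro mult_left_mono mult_mono abs_sin_le_one abs_sin_x_le_abs_x) auto
  finally show ?thesis by simp
qed

context iid_centered
begin

text \<open>
  The error of the estimator, scaled by \<open>sqrt N\<close>, is \<open>G\<close> applied to the normalised sum plus a remainder
  that tends to 0 in probability, because the derivative controls \<open>g\<close> near \<open>e\<close> and the normalised sum
  is tight. Cosines are Lipschitz, so the remainder disappears from their expectations, and the
  Cramer--Wold device gives convergence in law. The representation of \<open>T N\<close> is asked for only from
  \<open>N = 1\<close> on, since the mean of an empty sample is 0 and not \<open>e\<close>.
\<close>

lemma delta_method:
  fixes g :: "real ^ 'm \<Rightarrow> real ^ 'd" and T :: "nat \<Rightarrow> 'a \<Rightarrow> real ^ 'd"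
  assumes T [measurable]: "\<And>N. T N \<in> borel_measurable M"
    and T_eq: "\<And>N \<omega>. 1 \<le> N \<Longrightarrow> T N \<omega> = g (e + (1 / sqrt N) *\<^sub>R scaled_sum N \<omega>)"
    and deriv: "(g has_derivative (\<lambda>y. G *v y)) (at e)"
    and \<Theta>: "open \<Theta>" "g e \<in> \<Theta>"
  shows "has_asymptotic_cov M T \<Theta> (g e) (G ** V ** transpose G)"
proof -
  let ?S = "scaled_sum"
  \<comment> \<open>Outside an event of probability at most r the sample mean is within delta K of e. The
     radius may depend on the bound K for the normalised sum; the remainder term needs this.\<close>
  have near: "\<exists>K>0. \<exists>N0\<ge>1. \<forall>N\<ge>N0. prob {\<omega>\<in>space M. K < norm (?S N \<omega>)} \<le> r \<and>
      (\<forall>\<omega>. norm (?S N \<omega>) \<le> K \<longrightarrow> norm ((1 / sqrt N) *\<^sub>R ?S N \<omega>) < \<delta> K)"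
    if "0 < r" and \<delta>: "\<And>K. 0 < K \<Longrightarrow> 0 < \<delta> K" for r :: real and \<delta> :: "real \<Rightarrow> real"
  proof -
    obtain K where K: "0 < K" "\<And>N. prob {\<omega>\<in>space M. K < norm (?S N \<omega>)} \<le> r"
      using scaled_sum_tight[OF \<open>0 < r\<close>] by blast
    obtain N0 :: nat where N0: "(K / \<delta> K)\<^sup>2 < real N0"
      using reals_Archimedean2 by blast
    have "norm ((1 / sqrt N) *\<^sub>R ?S N \<omega>) < \<delta> K"
      if "max 1 N0 \<le> N" "norm (?S N \<omega>) \<le> K" for N \<omega>
    proof -
      have "(K / \<delta> K)\<^sup>2 < real N" using N0 that(1) by linarith
      then have "K / \<delta> K < sqrt N" by (rule real_less_rsqrt)
      then have "K / sqrt N < \<delta> K"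
        using \<delta>[OF K(1)] that(1) by (simp add: field_simps)
      moreover have "norm ((1 / sqrt N) *\<^sub>R ?S N \<omega>) \<le> K / sqrt N"
        using that(2) by (simp add: divide_right_mono)
      ultimately show ?thesis by linarith
    qed
    then have "\<forall>N\<ge>max 1 N0. prob {\<omega>\<in>space M. K < norm (?S N \<omega>)} \<le> r \<and>
        (\<forall>\<omega>. norm (?S N \<omega>) \<le> K \<longrightarrow> norm ((1 / sqrt N) *\<^sub>R ?S N \<omega>) < \<delta> K)"
      using K(2) by blast
    with K(1) show ?thesis by (meson max.cobounded1)
  qed
  have exists: "(\<lambda>N. prob {\<omega>\<in>space M. T N \<omega> \<in> \<Theta>}) \<longlonglongrightarrow> 1"
  proof (rule LIMSEQ_I)
    fix r :: real assume "0 < r"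
    have "continuous (at e) g" using deriv by (rule has_derivative_continuous)
    then have "\<forall>\<^sub>F y in nhds e. g y \<in> \<Theta>"
      using \<Theta> by (simp add: continuous_at_open eventually_nhds)
    then obtain \<delta> where \<delta>: "0 < \<delta>" "\<And>y. dist y e < \<delta> \<Longrightarrow> g y \<in> \<Theta>"
      by (auto simp: eventually_nhds_metric)
    obtain K N0 where N0: "1 \<le> N0" "\<And>N. N \<ge> N0 \<Longrightarrow> prob {\<omega>\<in>space M. K < norm (?S N \<omega>)} \<le> r / 2"
      "\<And>N \<omega>. N \<ge> N0 \<Longrightarrow> norm (?S N \<omega>) \<le> K \<Longrightarrow> norm ((1 / sqrt N) *\<^sub>R ?S N \<omega>) < \<delta>"
      using near[of "r / 2" "\<lambda>_. \<delta>"] \<open>0 < r\<close> \<delta>(1) by auto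
    have "\<bar>prob {\<omega>\<in>space M. T N \<omega> \<in> \<Theta>} - 1\<bar> < r" if "N \<ge> N0" for N
    proof -
      have [measurable]: "\<Theta> \<in> sets borel" using \<Theta>(1) by simp
      have in_\<Theta>: "T N \<omega> \<in> \<Theta>" if "norm (?S N \<omega>) \<le> K" for \<omega>
        using T_eq[of N \<omega>] N0(1) N0(3)[OF \<open>N \<ge> N0\<close> that] \<open>N \<ge> N0\<close>
          \<delta>(2)[of "e + (1 / sqrt N) *\<^sub>R ?S N \<omega>"] by (simp add: dist_norm)
      have "1 - prob {\<omega>\<in>space M. T N \<omega> \<in> \<Theta>} = prob (space M - {\<omega>\<in>space M. T N \<omega> \<in> \<Theta>})"
        by (subst prob_compl) auto
      also have "\<dots> \<le> prob {\<omega>\<in>space M. K < norm (?S N \<omega>)}"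
        using in_\<Theta> by (intro finite_measure_mono) (auto simp: not_less[symmetric])
      also have "\<dots> \<le> r / 2" by (rule N0(2)[OF that])
      finally show ?thesis
        using prob_le_1[of "{\<omega>\<in>space M. T N \<omega> \<in> \<Theta>}"] \<open>0 < r\<close> by linarith
    qed
    then show "\<exists>no. \<forall>n\<ge>no. norm (prob {\<omega>\<in>space M. T n \<omega> \<in> \<Theta>} - 1) < r" by auto
  qed
  define \<Sigma> where "\<Sigma> = G ** V ** transpose G"
  have quad: "a \<bullet> (\<Sigma> *v a) = (transpose G *v a) \<bullet> (V *v (transpose G *v a))" for a
    unfolding \<Sigma>_def
    by (metis dot_lmul_matrix matrix_vector_mul_assoc vector_transpose_matrix transpose_transpose)
  have "transpose \<Sigma> = \<Sigma>"
    unfolding \<Sigma>_def by (simp add: matrix_transpose_mul covariance_symmetric matrix_mul_assoc)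
  moreover have "0 \<le> a \<bullet> (\<Sigma> *v a)" for a
    unfolding quad by (rule quadratic_form_nonneg)
  ultimately obtain \<mu> where \<mu>: "is_centered_normal \<mu> \<Sigma>"
    using centered_normal_exists by blast
  then have sets_\<mu>: "sets \<mu> = sets borel"
    and proj_\<mu>: "\<And>t. distr \<mu> borel (\<lambda>x. t \<bullet> x) = normal_law (t \<bullet> (\<Sigma> *v t))"
    by (auto simp: is_centered_normal_def normal_law_def)
  note [measurable_cong] = sets_\<mu>
  have prob_\<mu>: "prob_space \<mu>"
  proof (rule prob_space_distrD)
    show "(\<lambda>x. 0 \<bullet> x) \<in> measurable \<mu> borel" by simp
    show "prob_space (distr \<mu> borel (\<lambda>x. 0 \<bullet> x))"
      unfolding proj_\<mu> by (simp add: normal_law_def prob_space_return)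
  qed
  define Y where "Y N \<omega> = sqrt (real N) *\<^sub>R (T N \<omega> - g e)" for N \<omega>
  define L where "L N \<omega> = G *v ?S N \<omega>" for N \<omega>
  have [measurable]: "Y N \<in> borel_measurable M" for N
    unfolding Y_def by measurable
  have [measurable]: "L N \<in> borel_measurable M" for N
  proof -
    have "(\<lambda>y. G *v y) \<in> borel_measurable borel"
      by (intro borel_measurable_continuous_onI linear_continuous_on matrix_vector_mul_bounded_linear)
    then show ?thesis unfolding L_def by simp
  qed
  \<comment> \<open>The slope tolerance eta / K turns the bound K on the normalised sum into the bound eta on
     the remainder.\<close>
  have remainder: "\<forall>\<^sub>F N in sequentially. prob {\<omega>\<in>space M. \<eta> < norm (Y N \<omega> - L N \<omega>)} \<le> r"
    if "0 < \<eta>" "0 < r" for \<eta> r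
  proof -
    have "\<forall>c>0. \<exists>d>0. \<forall>y. norm (y - e) < d \<longrightarrow> norm (g y - g e - G *v (y - e)) \<le> c * norm (y - e)"
      using deriv by (simp add: has_derivative_at_alt)
    then obtain d where d: "\<And>c. 0 < c \<Longrightarrow> 0 < d c"
      "\<And>c y. 0 < c \<Longrightarrow> norm (y - e) < d c \<Longrightarrow> norm (g y - g e - G *v (y - e)) \<le> c * norm (y - e)"
      by metis
    have "\<exists>K>0. \<exists>N0\<ge>1. \<forall>N\<ge>N0. prob {\<omega>\<in>space M. K < norm (?S N \<omega>)} \<le> r \<and>
        (\<forall>\<omega>. norm (?S N \<omega>) \<le> K \<longrightarrow> norm ((1 / sqrt N) *\<^sub>R ?S N \<omega>) < d (\<eta> / K))"
      by (rule near) (use d(1) that in simp_all)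
    then obtain K N0 where K: "0 < K" and "1 \<le> N0"
      and N0': "\<forall>N\<ge>N0. prob {\<omega>\<in>space M. K < norm (?S N \<omega>)} \<le> r \<and>
        (\<forall>\<omega>. norm (?S N \<omega>) \<le> K \<longrightarrow> norm ((1 / sqrt N) *\<^sub>R ?S N \<omega>) < d (\<eta> / K))"
      by (elim exE conjE) (rule that)
    note N0 = \<open>1 \<le> N0\<close> N0'[rule_format, THEN conjunct1] N0'[rule_format, THEN conjunct2, rule_format]
    have "prob {\<omega>\<in>space M. \<eta> < norm (Y N \<omega> - L N \<omega>)} \<le> r" if "N \<ge> N0" for N
    proof -
      have "norm (Y N \<omega> - L N \<omega>) \<le> \<eta>" if S: "norm (?S N \<omega>) \<le> K" for \<omega>
      proof -
        have "0 < sqrt N" using N0(1) \<open>N \<ge> N0\<close> by simp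
        let ?y = "e + (1 / sqrt N) *\<^sub>R ?S N \<omega>"
        have bound: "norm (g ?y - g e - G *v (?y - e)) \<le> \<eta> / K * norm (?y - e)"
          using N0(3)[OF \<open>N \<ge> N0\<close> S] K \<open>0 < \<eta>\<close> by (intro d(2)) auto
        have eq: "Y N \<omega> - L N \<omega> = sqrt N *\<^sub>R (g ?y - g e - G *v (?y - e))"
          using T_eq[of N \<omega>] N0(1) \<open>N \<ge> N0\<close> \<open>0 < sqrt N\<close>
          by (simp add: Y_def L_def scaleR_right_diff_distrib matrix_vector_mult_scaleR)
        have "norm (Y N \<omega> - L N \<omega>) = sqrt N * norm (g ?y - g e - G *v (?y - e))"
          unfolding eq by simp
        also have "\<dots> \<le> sqrt N * (\<eta> / K * norm (?y - e))"
          using bound by (intro mult_left_mono) auto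
        also have "\<dots> = \<eta> / K * norm (?S N \<omega>)"
          using \<open>0 < sqrt N\<close> by simp
        also have "\<dots> \<le> \<eta> / K * K"
          using S K \<open>0 < \<eta>\<close> by (intro mult_left_mono) auto
        finally show ?thesis using K by simp
      qed
      then have "prob {\<omega>\<in>space M. \<eta> < norm (Y N \<omega> - L N \<omega>)} \<le> prob {\<omega>\<in>space M. K < norm (?S N \<omega>)}"
        by (intro finite_measure_mono) (auto simp: not_less[symmetric])
      with N0(2)[OF that] show ?thesis by linarith
    qed
    then show ?thesis by (auto simp: eventually_sequentially)
  qed
  have cos_conv: "(\<lambda>N. expectation (\<lambda>\<omega>. cos (t \<bullet> Y N \<omega> + s))) \<longlonglongrightarrow> (LINT x|\<mu>. cos (t \<bullet> x + s))" for t s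
  proof -
    have "(LINT x|\<mu>. cos (t \<bullet> x + s)) = (LINT x|normal_law (t \<bullet> (\<Sigma> *v t)). cos (x + s))"
      unfolding proj_\<mu>[symmetric] by (subst integral_distr) auto
    moreover have "t \<bullet> L N \<omega> = (transpose G *v t) \<bullet> ?S N \<omega>" for N \<omega>
      unfolding L_def by (metis dot_lmul_matrix vector_transpose_matrix transpose_transpose)
    ultimately have L_conv: "(\<lambda>N. expectation (\<lambda>\<omega>. cos (t \<bullet> L N \<omega> + s))) \<longlonglongrightarrow> (LINT x|\<mu>. cos (t \<bullet> x + s))"
      using scaled_sum_cos_tendsto[of "transpose G *v t" s] by (simp add: quad)
    have "(\<lambda>N. expectation (\<lambda>\<omega>. cos (t \<bullet> Y N \<omega> + s)) - expectation (\<lambda>\<omega>. cos (t \<bullet> L N \<omega> + s))) \<longlonglongrightarrow> 0"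
    proof (rule LIMSEQ_I)
      fix r :: real assume "0 < r"
      \<comment> \<open>The summand 1 avoids division by zero when t = 0.\<close>
      define \<eta> where "\<eta> = r / (3 * (norm t + 1))"
      have "0 < norm t + 1" by (simp add: add_nonneg_pos)
      then have "0 < \<eta>" "norm t * \<eta> < r / 2"
        using \<open>0 < r\<close> by (simp_all add: \<eta>_def field_simps add_nonneg_pos)
      have "\<bar>expectation (\<lambda>\<omega>. cos (t \<bullet> Y N \<omega> + s)) - expectation (\<lambda>\<omega>. cos (t \<bullet> L N \<omega> + s))\<bar> < r"
        if N: "prob {\<omega>\<in>space M. \<eta> < norm (Y N \<omega> - L N \<omega>)} \<le> r / 4" for N
      proof -
        have "\<bar>expectation (\<lambda>\<omega>. cos (t \<bullet> Y N \<omega> + s) - cos (t \<bullet> L N \<omega> + s))\<bar>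
            \<le> norm t * \<eta> + 2 * prob {\<omega>\<in>space M. \<eta> < norm (Y N \<omega> - L N \<omega>)}"
        proof (rule abs_expectation_le_off_event)
          show "0 \<le> norm t * \<eta>" using \<open>0 < \<eta>\<close> by simp
          fix \<omega> assume \<omega>: "\<omega> \<in> space M"
          show "\<bar>cos (t \<bullet> Y N \<omega> + s) - cos (t \<bullet> L N \<omega> + s)\<bar> \<le> 2"
            using cos_ge_minus_one[of "t \<bullet> Y N \<omega> + s"] cos_ge_minus_one[of "t \<bullet> L N \<omega> + s"]
              cos_le_one[of "t \<bullet> Y N \<omega> + s"] cos_le_one[of "t \<bullet> L N \<omega> + s"] by linarith
          assume "\<omega> \<notin> {\<omega>\<in>space M. \<eta> < norm (Y N \<omega> - L N \<omega>)}"
          with \<omega> have "norm (Y N \<omega> - L N \<omega>) \<le> \<eta>" by simp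
          have "\<bar>cos (t \<bullet> Y N \<omega> + s) - cos (t \<bullet> L N \<omega> + s)\<bar> \<le> \<bar>(t \<bullet> Y N \<omega> + s) - (t \<bullet> L N \<omega> + s)\<bar>"
            by (rule abs_cos_diff_le)
          also have "\<dots> = \<bar>t \<bullet> (Y N \<omega> - L N \<omega>)\<bar>" by (simp add: inner_diff_right)
          also have "\<dots> \<le> norm t * norm (Y N \<omega> - L N \<omega>)" by (rule Cauchy_Schwarz_ineq2)
          also have "\<dots> \<le> norm t * \<eta>"
            using \<open>norm (Y N \<omega> - L N \<omega>) \<le> \<eta>\<close> by (intro mult_left_mono) auto
          finally show "\<bar>cos (t \<bullet> Y N \<omega> + s) - cos (t \<bullet> L N \<omega> + s)\<bar> \<le> norm t * \<eta>" .
        qed measurable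
        moreover have "integrable M (\<lambda>\<omega>. cos (t \<bullet> Y N \<omega> + s))" "integrable M (\<lambda>\<omega>. cos (t \<bullet> L N \<omega> + s))"
          by (auto intro!: integrable_const_bound[where B = 1])
        ultimately show ?thesis
          using N \<open>norm t * \<eta> < r / 2\<close> by simp
      qed
      then have "\<forall>\<^sub>F N in sequentially.
          \<bar>expectation (\<lambda>\<omega>. cos (t \<bullet> Y N \<omega> + s)) - expectation (\<lambda>\<omega>. cos (t \<bullet> L N \<omega> + s))\<bar> < r"
        using remainder[OF \<open>0 < \<eta>\<close>, of "r / 4"] \<open>0 < r\<close> by (auto elim: eventually_mono)
      then show "\<exists>no. \<forall>n\<ge>no. norm (expectation (\<lambda>\<omega>. cos (t \<bullet> Y n \<omega> + s)) -
          expectation (\<lambda>\<omega>. cos (t \<bullet> L n \<omega> + s)) - 0) < r"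
        by (simp add: eventually_sequentially)
    qed
    from tendsto_add[OF this L_conv] show ?thesis by simp
  qed
  have tight: "\<exists>K. \<forall>\<^sub>F N in sequentially. prob {\<omega>\<in>space M. K < norm (Y N \<omega>)} \<le> r" if "0 < r" for r
  proof -
    obtain B where B: "0 < B" "\<And>y. norm (G *v y) \<le> norm y * B"
      using bounded_linear.pos_bounded[OF matrix_vector_mul_bounded_linear] by blast
    obtain K where K: "0 < K" "\<And>N. prob {\<omega>\<in>space M. K < norm (?S N \<omega>)} \<le> r / 2"
      using scaled_sum_tight[of "r / 2"] \<open>0 < r\<close> by auto
    have "prob {\<omega>\<in>space M. K * B + 1 < norm (Y N \<omega>)} \<le> r"
      if N: "prob {\<omega>\<in>space M. 1 < norm (Y N \<omega> - L N \<omega>)} \<le> r / 2" for N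
    proof -
      have "K < norm (?S N \<omega>) \<or> 1 < norm (Y N \<omega> - L N \<omega>)" if "K * B + 1 < norm (Y N \<omega>)" for \<omega>
      proof (rule ccontr)
        assume "\<not> ?thesis"
        then have *: "norm (?S N \<omega>) \<le> K" "norm (Y N \<omega> - L N \<omega>) \<le> 1" by auto
        have "norm (L N \<omega>) \<le> K * B"
          unfolding L_def using B *(1) by (meson mult_right_mono order_trans less_imp_le)
        with * that norm_triangle_sub[of "Y N \<omega>" "L N \<omega>"] show False by linarith
      qed
      then have "prob {\<omega>\<in>space M. K * B + 1 < norm (Y N \<omega>)} \<le>
          prob ({\<omega>\<in>space M. K < norm (?S N \<omega>)} \<union> {\<omega>\<in>space M. 1 < norm (Y N \<omega> - L N \<omega>)})"
        by (intro finite_measure_mono) auto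
      also have "\<dots> \<le> prob {\<omega>\<in>space M. K < norm (?S N \<omega>)} + prob {\<omega>\<in>space M. 1 < norm (Y N \<omega> - L N \<omega>)}"
        by (intro measure_Un_le) measurable
      also have "\<dots> \<le> r / 2 + r / 2" by (intro add_mono K(2) N)
      finally show ?thesis by simp
    qed
    moreover have "\<forall>\<^sub>F N in sequentially. prob {\<omega>\<in>space M. 1 < norm (Y N \<omega> - L N \<omega>)} \<le> r / 2"
      using \<open>0 < r\<close> by (intro remainder) auto
    ultimately show ?thesis
      by (intro exI[of _ "K * B + 1"]) (rule eventually_mono)
  qed
  have "converges_in_law M Y \<mu>"
    unfolding converges_in_law_def
    using expectation_tendsto_of_cos[OF prob_space_axioms prob_\<mu> sets_\<mu> _ cos_conv tight] by auto
  with exists \<mu> show ?thesis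
    unfolding has_asymptotic_cov_def \<Sigma>_def Y_def by blast
qed

end

theorem delta_method_iid:
  fixes X :: "nat \<Rightarrow> 'a \<Rightarrow> 'b::topological_space" and h :: "'b \<Rightarrow> real ^ 'm" and g :: "real ^ 'm \<Rightarrow> real ^ 'd"
  assumes "prob_space M" and indep: "prob_space.indep_vars M (\<lambda>_. borel) X UNIV"
    and law: "\<And>n. distr M borel (X n) = P"
    and h [measurable]: "h \<in> borel_measurable borel" and g [measurable]: "g \<in> borel_measurable borel"
    and sq: "\<And>i. integrable P (\<lambda>x. (h x $ i)\<^sup>2)"
    and deriv: "(g has_derivative (\<lambda>y. G *v y)) (at (LINT x|P. h x))"
    and \<Theta>: "open \<Theta>" "g (LINT x|P. h x) \<in> \<Theta>"
  shows "has_asymptotic_cov M (\<lambda>N \<omega>. g (sample_mean N (\<lambda>n. h (X n \<omega>)))) \<Theta> (g (LINT x|P. h x))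
      (G ** cov_matrix P h ** transpose G)"
proof -
  interpret prob_space M by fact
  have [measurable]: "X n \<in> borel_measurable M" for n
    using indep unfolding indep_vars_def2 by simp
  interpret P: prob_space P
    unfolding law[of 0, symmetric] by (rule prob_space_distr) simp
  have sets_P [measurable_cong]: "sets P = sets borel" unfolding law[of 0, symmetric] by simp
  have int: "integrable P (\<lambda>x. h x $ i)" for i
    by (rule P.square_integrable_imp_integrable[OF _ sq]) simp
  define e where "e = (LINT x|P. h x)"
  have e: "e $ i = (LINT x|P. h x $ i)" for i
    unfolding e_def using int by (intro integral_vec_nth integrable_vec)
  have transfer: "expectation (\<lambda>\<omega>. f (X n \<omega>)) = (LINT x|P. f x)" "integrable M (\<lambda>\<omega>. f (X n \<omega>)) = integrable P f"
    if "f \<in> borel_measurable borel" for f :: "'b \<Rightarrow> real" and n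
    unfolding law[of n, symmetric] using that by (simp_all add: integral_distr integrable_distr_eq)
  interpret iid_centered M "\<lambda>n \<omega>. h (X n \<omega>) - e" "cov_matrix P h"
  proof
    show "indep_vars (\<lambda>_. borel) (\<lambda>n \<omega>. h (X n \<omega>) - e) UNIV"
      by (rule indep_vars_compose2[OF indep, where Y = "\<lambda>_ x. h x - e"]) simp
    have "distr M borel (\<lambda>\<omega>. h (X k \<omega>) - e) = distr (distr M borel (X k)) borel (\<lambda>x. h x - e)" for k
      by (subst distr_distr) (auto simp: o_def)
    then show "distr M borel (\<lambda>\<omega>. h (X n \<omega>) - e) = distr M borel (\<lambda>\<omega>. h (X 0 \<omega>) - e)" for n
      by (simp only: law)
    show "expectation (\<lambda>\<omega>. (h (X n \<omega>) - e) $ i) = 0" for n i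
      by (subst transfer) (simp_all add: int e P.prob_space)
    show "integrable M (\<lambda>\<omega>. ((h (X n \<omega>) - e) $ i)\<^sup>2)" for n i
      by (subst transfer) (simp_all add: int sq power2_diff)
    show "expectation (\<lambda>\<omega>. (h (X n \<omega>) - e) $ i * (h (X n \<omega>) - e) $ j) = cov_matrix P h $ i $ j" for n i j
      by (subst transfer) (simp_all add: cov_matrix_def e)
  qed
  show ?thesis
    unfolding e_def[symmetric]
  proof (rule delta_method)
    show "(\<lambda>\<omega>. g (sample_mean N (\<lambda>n. h (X n \<omega>)))) \<in> borel_measurable M" for N
      unfolding sample_mean_def by measurable
    show "g (sample_mean N (\<lambda>n. h (X n \<omega>))) = g (e + (1 / sqrt N) *\<^sub>R scaled_sum N \<omega>)" if "1 \<le> N" for N \<omega>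
    proof -
      have "sample_mean N (\<lambda>n. h (X n \<omega>)) = e + (1 / sqrt N) *\<^sub>R scaled_sum N \<omega>"
        using that by (simp add: scaled_sum_def sample_mean_def sum_subtractf sum_constant_scaleR
            scaleR_right_diff_distrib del: sum_constant flip: real_sqrt_mult)
      then show ?thesis by simp
    qed
  qed (use deriv \<Theta> in \<open>simp_all add: e_def\<close>)
qed

section \<open>Logarithmic moments of the Gamma distribution\<close>

text \<open>
  The Gamma distribution with shape \<open>a\<close> and scale \<open>b\<close>.
\<close>

definition gamma_density :: "real \<Rightarrow> real \<Rightarrow> real \<Rightarrow> real" where
  "gamma_density a b x = (if 0 < x then x powr (a - 1) * exp (- x / b) / (b powr a * Gamma a) else 0)"

definition gamma_law :: "real \<Rightarrow> real \<Rightarrow> real measure" where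
  "gamma_law a b = density lborel (\<lambda>x. ennreal (gamma_density a b x))"

lemma Gamma_real_nonzero: "0 < x \<Longrightarrow> Gamma x \<noteq> (0 :: real)"
  by (rule less_imp_neq[THEN not_sym]) (rule Gamma_real_pos)

lemma gamma_density_nonneg: "0 < a \<Longrightarrow> 0 < b \<Longrightarrow> 0 \<le> gamma_density a b x"
  by (simp add: gamma_density_def Gamma_real_pos less_imp_le)

lemma measurable_gamma_density [measurable]: "gamma_density a b \<in> borel_measurable borel"
  unfolding gamma_density_def by measurable

lemma sets_gamma_law [measurable_cong]: "sets (gamma_law a b) = sets borel"
  by (simp add: gamma_law_def)

lemma nn_integral_gamma_density:
  assumes a: "0 < a" and b: "0 < b"
  shows "(\<integral>\<^sup>+x. ennreal (gamma_density a b x) \<partial>lborel) = 1"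
proof -
  have pos: "0 < b powr a * Gamma a" using a b by (simp add: Gamma_real_pos)
  have "ennreal (Gamma a) = (\<integral>\<^sup>+t. ennreal (indicator {0..} t * t powr (a - 1) / exp t) \<partial>lborel)"
    by (rule Gamma_conv_nn_integral_real[OF a])
  also have "\<dots> = \<bar>1 / b\<bar> * (\<integral>\<^sup>+x. ennreal (indicator {0..} (0 + 1 / b * x) * (0 + 1 / b * x) powr (a - 1) /
      exp (0 + 1 / b * x)) \<partial>lborel)"
    by (rule nn_integral_real_affine) (use b in auto)
  also have "\<dots> = ennreal (1 / b) * (\<integral>\<^sup>+x. ennreal (b * Gamma a) * ennreal (gamma_density a b x) \<partial>lborel)"
  proof -
    have "indicator {0..} (0 + 1 / b * x) * (0 + 1 / b * x) powr (a - 1) / exp (0 + 1 / b * x) =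
        b * Gamma a * gamma_density a b x" for x
      using b Gamma_real_pos[OF a]
      by (cases "x = 0")
         (auto simp: indicator_def gamma_density_def zero_le_divide_iff powr_divide powr_diff exp_minus field_simps)
    then show ?thesis
      using b Gamma_real_pos[OF a] gamma_density_nonneg[OF a b]
      by (simp add: ennreal_mult'[symmetric])
  qed
  also have "\<dots> = ennreal (Gamma a) * (\<integral>\<^sup>+x. ennreal (gamma_density a b x) \<partial>lborel)"
    using b Gamma_real_pos[OF a]
    by (subst nn_integral_cmult) (simp_all add: mult.assoc[symmetric] ennreal_mult'[symmetric])
  finally have eq: "ennreal (Gamma a) = ennreal (Gamma a) * (\<integral>\<^sup>+x. ennreal (gamma_density a b x) \<partial>lborel)" .
  have "ennreal (Gamma a) * 1 = ennreal (Gamma a) * (\<integral>\<^sup>+x. ennreal (gamma_density a b x) \<partial>lborel)"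
    using eq by simp
  then show ?thesis
    using Gamma_real_pos[OF a] by (subst (asm) ennreal_mult_cancel_left) auto
qed

lemma prob_space_gamma_law: "0 < a \<Longrightarrow> 0 < b \<Longrightarrow> prob_space (gamma_law a b)"
  unfolding gamma_law_def by (rule prob_spaceI) (simp add: emeasure_density nn_integral_gamma_density)

text \<open>
  Multiplication by a power of \<open>x\<close> only shifts the shape, up to a constant. Hence a moment that contains
  a power of \<open>x\<close> is a moment without that power at another shape.
\<close>

lemma gamma_density_tilt:
  assumes "0 < a" "0 < b" "0 < a + s"
  shows "gamma_density a b x * x powr s = (b powr s * Gamma (a + s) / Gamma a) * gamma_density (a + s) b x"
proof (cases "0 < x")
  case True
  have "Gamma (a + s) \<noteq> 0" "Gamma a \<noteq> 0" using assms by (simp_all add: Gamma_real_nonzero)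
  then show ?thesis
    using True assms(1,2) by (simp add: gamma_density_def powr_add powr_diff field_simps)
qed (simp add: gamma_density_def)

lemma AE_gamma_law_pos: "AE x in gamma_law a b. 0 < x"
  unfolding gamma_law_def by (subst AE_density) (auto simp: gamma_density_def)

lemma AE_gamma_lawI: "(\<And>x. 0 < x \<Longrightarrow> P x) \<Longrightarrow> AE x in gamma_law a b. P x"
  using AE_gamma_law_pos by (rule eventually_mono)

lemma gamma_law_tilt:
  fixes f :: "real \<Rightarrow> real"
  assumes ab: "0 < a" "0 < b" "0 < a + s" and [measurable]: "f \<in> borel_measurable borel"
  shows "integrable (gamma_law a b) (\<lambda>x. x powr s * f x) \<longleftrightarrow> integrable (gamma_law (a + s) b) f" (is ?int)
    and "(LINT x|gamma_law a b. x powr s * f x) =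
      b powr s * Gamma (a + s) / Gamma a * (LINT x|gamma_law (a + s) b. f x)" (is ?eq)
proof -
  define C where "C = b powr s * Gamma (a + s) / Gamma a"
  have "0 < C" using ab by (simp add: C_def Gamma_real_pos)
  then have "C \<noteq> 0" by simp
  have tilt: "gamma_density a b x * (x powr s * f x) = C * (gamma_density (a + s) b x * f x)" for x
    using gamma_density_tilt[OF ab, of x] by (simp add: C_def mult.assoc[symmetric])
  have "integrable (gamma_law a b) (\<lambda>x. x powr s * f x) \<longleftrightarrow>
      integrable lborel (\<lambda>x. C * (gamma_density (a + s) b x * f x))"
    unfolding gamma_law_def using gamma_density_nonneg[of a b] ab
    by (subst integrable_density) (auto simp: tilt)
  also have "\<dots> \<longleftrightarrow> integrable (gamma_law (a + s) b) f"
    unfolding gamma_law_def using gamma_density_nonneg[of "a + s" b] ab \<open>C \<noteq> 0\<close>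
    by (subst integrable_density) auto
  finally show ?int .
  have "(LINT x|gamma_law a b. x powr s * f x) = (LINT x|lborel. C * (gamma_density (a + s) b x * f x))"
    unfolding gamma_law_def using gamma_density_nonneg[of a b] ab
    by (subst integral_density) (auto simp: tilt)
  also have "\<dots> = C * (LINT x|gamma_law (a + s) b. f x)"
    unfolding gamma_law_def using gamma_density_nonneg[of "a + s" b] ab
    by (subst integral_density) auto
  finally show ?eq by (simp add: C_def)
qed

lemma gamma_law_powr:
  assumes ab: "0 < a" "0 < b" "0 < a + s"
  shows "integrable (gamma_law a b) (\<lambda>x. x powr s)"
    and "(LINT x|gamma_law a b. x powr s) = b powr s * Gamma (a + s) / Gamma a"
proof -
  interpret prob_space "gamma_law (a + s) b" using ab by (intro prob_space_gamma_law)
  show "integrable (gamma_law a b) (\<lambda>x. x powr s)"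
    using gamma_law_tilt(1)[OF ab, of "\<lambda>_. 1"] by simp
  show "(LINT x|gamma_law a b. x powr s) = b powr s * Gamma (a + s) / Gamma a"
    using gamma_law_tilt(2)[OF ab, of "\<lambda>_. 1"] by (simp add: prob_space)
qed

text \<open>
  Arbitrarily small powers dominate the logarithm at 0 and at infinity. A negative power \<open>x powr (- s)\<close>
  is integrable against a Gamma density only for \<open>s < a\<close>, so \<open>r\<close> has to be adapted to the shape.
\<close>

lemma abs_ln_le_powr:
  fixes x :: real
  assumes "0 < x" "0 < r"
  shows "\<bar>ln x\<bar> \<le> (x powr r + x powr (- r)) / r"
proof -
  have "r * ln x \<le> x powr r" "r * (- ln x) \<le> x powr (- r)"
    using ln_less_self[of "x powr r"] ln_less_self[of "x powr (- r)"] assms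
    by (simp_all add: ln_powr)
  moreover have "0 < x powr r" "0 < x powr (- r)" using assms by auto
  ultimately have "r * ln x \<le> x powr r + x powr (- r)" "r * (- ln x) \<le> x powr r + x powr (- r)"
    by linarith+
  then have "r * \<bar>ln x\<bar> \<le> x powr r + x powr (- r)"
    by (auto simp: abs_if)
  then show ?thesis using \<open>0 < r\<close> by (simp add: field_simps)
qed

lemma gamma_law_ln_square_integrable:
  assumes ab: "0 < a" "0 < b"
  shows "integrable (gamma_law a b) (\<lambda>x. (ln x)\<^sup>2)"
proof (rule Bochner_Integration.integrable_bound)
  define r where "r = a / 3"
  have "0 < r" "0 < a + 2 * r" "0 < a + - (2 * r)" using ab by (simp_all add: r_def)
  interpret prob_space "gamma_law a b" using ab by (intro prob_space_gamma_law)
  show "integrable (gamma_law a b) (\<lambda>x. (x powr (2 * r) + 2 + x powr (- (2 * r))) / r\<^sup>2)"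
    using ab \<open>0 < a + 2 * r\<close> \<open>0 < a + - (2 * r)\<close>
    by (intro integrable_divide Bochner_Integration.integrable_add gamma_law_powr) auto
  show "AE x in gamma_law a b. norm ((ln x)\<^sup>2) \<le> norm ((x powr (2 * r) + 2 + x powr (- (2 * r))) / r\<^sup>2)"
    using AE_gamma_law_pos
  proof eventually_elim
    case (elim x)
    have "(ln x)\<^sup>2 \<le> ((x powr r + x powr (- r)) / r)\<^sup>2"
      using power_mono[OF abs_ln_le_powr[OF elim \<open>0 < r\<close>], of 2] by simp
    also have "\<dots> = (x powr (2 * r) + 2 + x powr (- (2 * r))) / r\<^sup>2"
    proof -
      have "(x powr r)\<^sup>2 = x powr (2 * r)" "(x powr (- r))\<^sup>2 = x powr (- (2 * r))"
        "x powr r * x powr (- r) = 1"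
        using elim by (simp_all add: power2_eq_square flip: powr_add)
      then show ?thesis by (simp add: power_divide power2_sum)
    qed
    finally show ?case by simp
  qed
qed (simp add: gamma_law_def)

text \<open>
  An integrable majorant, independent of \<open>h\<close>, for the difference quotients whose limit is \<open>ln x\<close>. It
  rests on \<open>\<bar>exp u - 1\<bar> \<le> \<bar>u\<bar> * (1 + exp u)\<close> at \<open>u = h * ln x\<close>.
\<close>

lemma abs_powr_difference_quotient_le:
  fixes x h :: real
  assumes "0 < x" "0 < h" "h \<le> 1"
  shows "\<bar>(x powr h - 1) / h\<bar> \<le> (ln x)\<^sup>2 + (2 + x)\<^sup>2"
proof -
  define u where "u = h * ln x"
  have xh: "x powr h = exp u" using assms by (simp add: powr_def u_def)
  have "\<bar>exp u - 1\<bar> \<le> \<bar>u\<bar> * (1 + exp u)"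
  proof (cases "0 \<le> u")
    case True
    have "1 - u \<le> exp (- u)" using exp_ge_add_one_self[of "- u"] by simp
    then have "exp u * (1 - u) \<le> exp u * exp (- u)" by (intro mult_left_mono) auto
    also have "exp u * exp (- u) = 1" by (simp add: exp_minus)
    finally have "exp u - 1 \<le> u * exp u" by (simp add: algebra_simps)
    with True show ?thesis by (simp add: distrib_left)
  next
    case False
    have "1 - exp u \<le> - u" using exp_ge_add_one_self[of u] by linarith
    moreover have "- u * 1 \<le> - u * (1 + exp u)" using False by (intro mult_left_mono) auto
    ultimately have "1 - exp u \<le> - u * (1 + exp u)" by linarith
    moreover have "exp u \<le> 1" using False by simp
    ultimately show ?thesis using False by simp
  qed
  moreover have "exp u \<le> 1 + x"
  proof (cases "1 \<le> x")
    case True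
    then have "x powr h \<le> x powr 1" using assms by (intro powr_mono) auto
    with True show ?thesis by (simp add: xh[symmetric])
  next
    case False
    then have "u \<le> 0" using assms by (simp add: u_def mult_nonneg_nonpos)
    then have "exp u \<le> 1" by simp
    with assms show ?thesis by linarith
  qed
  ultimately have "\<bar>exp u - 1\<bar> \<le> \<bar>u\<bar> * (2 + x)"
    by (smt (verit) mult_left_mono abs_ge_zero)
  then have "\<bar>(x powr h - 1) / h\<bar> \<le> \<bar>ln x\<bar> * (2 + x)"
    using assms by (simp add: xh u_def abs_mult divide_simps mult_ac)
  also have "\<dots> \<le> (ln x)\<^sup>2 + (2 + x)\<^sup>2"
    using sum_squares_bound[of "\<bar>ln x\<bar>" "2 + x"] mult_nonneg_nonneg[of "\<bar>ln x\<bar>" "2 + x"] assms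
    unfolding power2_abs by linarith
  finally show ?thesis .
qed

lemma DERIV_sequence_quotient:
  fixes f :: "real \<Rightarrow> real"
  assumes "(f has_real_derivative D) (at 0)"
  shows "(\<lambda>n. (f (1 / real (Suc n)) - f 0) / (1 / real (Suc n))) \<longlonglongrightarrow> D"
proof -
  have "filterlim (\<lambda>n. 1 / real (Suc n)) (at 0) sequentially"
    using LIMSEQ_inverse_real_of_nat by (auto simp: filterlim_at inverse_eq_divide)
  moreover have "((\<lambda>h. (f h - f 0) / h) \<longlongrightarrow> D) (at 0)"
    using assms by (simp add: DERIV_def)
  ultimately show ?thesis by (rule filterlim_compose[rotated])
qed

text \<open>
  The function \<open>t \<mapsto> x powr t\<close> has derivative \<open>ln x\<close> at 0. Under the integral sign this gives the mean
  of the logarithm as the derivative at 0 of \<open>b powr t * Gamma (a + t) / Gamma a\<close>.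
\<close>

lemma gamma_law_ln:
  assumes ab: "0 < a" "0 < b"
  shows "(LINT x|gamma_law a b. ln x) = Digamma a + ln b"
proof -
  interpret prob_space "gamma_law a b" using ab by (intro prob_space_gamma_law)
  define h where "h n = 1 / real (Suc n)" for n
  have h: "0 < h n" "h n \<le> 1" for n by (simp_all add: h_def)
  have pos: "0 < a + h n" for n using ab h(1)[of n] by linarith
  have sq: "integrable (gamma_law a b) (\<lambda>x. x)" "integrable (gamma_law a b) (\<lambda>x. x\<^sup>2)"
  proof -
    have "integrable (gamma_law a b) (\<lambda>x. x) \<longleftrightarrow> integrable (gamma_law a b) (\<lambda>x. x powr 1)"
      by (rule integrable_cong_AE) (auto intro!: AE_gamma_lawI)
    then show "integrable (gamma_law a b) (\<lambda>x. x)" using gamma_law_powr(1)[of a b 1] ab by simp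
    have "integrable (gamma_law a b) (\<lambda>x. x\<^sup>2) \<longleftrightarrow> integrable (gamma_law a b) (\<lambda>x. x powr 2)"
      by (rule integrable_cong_AE) (auto intro!: AE_gamma_lawI)
    then show "integrable (gamma_law a b) (\<lambda>x. x\<^sup>2)" using gamma_law_powr(1)[of a b 2] ab by simp
  qed
  have "(\<lambda>n. LINT x|gamma_law a b. (x powr h n - 1) / h n) \<longlonglongrightarrow> (LINT x|gamma_law a b. ln x)"
  proof (rule integral_dominated_convergence)
    show "integrable (gamma_law a b) (\<lambda>x. (ln x)\<^sup>2 + (2 + x)\<^sup>2)"
      using gamma_law_ln_square_integrable[OF ab] sq by (simp add: power2_sum)
    show "AE x in gamma_law a b. (\<lambda>n. (x powr h n - 1) / h n) \<longlonglongrightarrow> ln x"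
      using AE_gamma_law_pos
    proof eventually_elim
      case (elim x)
      have "((\<lambda>t. x powr t) has_real_derivative ln x) (at 0)"
        using elim by (auto intro!: derivative_eq_intros)
      from DERIV_sequence_quotient[OF this] show ?case using elim by (simp add: h_def)
    qed
    show "AE x in gamma_law a b. norm ((x powr h n - 1) / h n) \<le> (ln x)\<^sup>2 + (2 + x)\<^sup>2" for n
      using AE_gamma_law_pos
    proof eventually_elim
      case (elim x)
      then show ?case using abs_powr_difference_quotient_le[OF elim h] by simp
    qed
  qed (simp_all add: gamma_law_def)
  moreover have "(\<lambda>n. LINT x|gamma_law a b. (x powr h n - 1) / h n) \<longlonglongrightarrow> Digamma a + ln b"
  proof -
    have "a \<notin> \<int>\<^sub>\<le>\<^sub>0" using ab Gamma_eq_zero_iff[of a] Gamma_real_nonzero[of a] by simp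
    moreover have "Gamma a \<noteq> 0" using ab by (simp add: Gamma_real_nonzero)
    ultimately have "((\<lambda>t. b powr t * Gamma (a + t) / Gamma a) has_real_derivative Digamma a + ln b) (at 0)"
      using ab by (auto intro!: derivative_eq_intros simp: field_simps)
    from DERIV_sequence_quotient[OF this]
    have "(\<lambda>n. (b powr h n * Gamma (a + h n) / Gamma a - 1) / h n) \<longlonglongrightarrow> Digamma a + ln b"
      using ab \<open>Gamma a \<noteq> 0\<close> by (simp add: h_def)
    moreover have "(LINT x|gamma_law a b. (x powr h n - 1) / h n) = (b powr h n * Gamma (a + h n) / Gamma a - 1) / h n" for n
      using gamma_law_powr[OF ab pos] by (simp add: prob_space)
    ultimately show ?thesis by (simp only:)
  qed
  ultimately show ?thesis by (rule LIMSEQ_unique)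
qed

text \<open>
  Passing from shape \<open>a\<close> to \<open>a + 1\<close> changes the digamma function by \<open>1 / a\<close>. In the last identity this
  produces the summand \<open>b\<close>, by which the covariance of \<open>x\<close> and \<open>ln x\<close> equals the scale.
\<close>

lemma gamma_law_moments:
  assumes ab: "0 < a" "0 < b"
  shows "integrable (gamma_law a b) (\<lambda>x. x\<^sup>2)"
    and "integrable (gamma_law a b) (\<lambda>x. (ln x)\<^sup>2)"
    and "integrable (gamma_law a b) (\<lambda>x. (x * ln x)\<^sup>2)"
    and "(LINT x|gamma_law a b. x) = a * b"
    and "(LINT x|gamma_law a b. ln x) = Digamma a + ln b"
    and "(LINT x|gamma_law a b. x * ln x) = a * b * (Digamma a + ln b) + b"
proof -
  have "a \<notin> \<int>\<^sub>\<le>\<^sub>0" using ab Gamma_eq_zero_iff[of a] Gamma_real_nonzero[of a] by simp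
  then have a1: "Gamma (a + 1) = a * Gamma a" by (rule Gamma_plus1)
  have "Gamma a \<noteq> 0" using ab by (simp add: Gamma_real_nonzero)
  then have ratio: "b powr 1 * Gamma (a + 1) / Gamma a = a * b"
    unfolding a1 using ab(2) by simp
  have "integrable (gamma_law a b) (\<lambda>x. x\<^sup>2) \<longleftrightarrow> integrable (gamma_law a b) (\<lambda>x. x powr 2)"
    by (rule integrable_cong_AE) (auto intro!: AE_gamma_lawI)
  then show "integrable (gamma_law a b) (\<lambda>x. x\<^sup>2)" using gamma_law_powr(1)[of a b 2] ab by simp
  show "integrable (gamma_law a b) (\<lambda>x. (ln x)\<^sup>2)" by (rule gamma_law_ln_square_integrable[OF ab])
  have "integrable (gamma_law a b) (\<lambda>x. (x * ln x)\<^sup>2) \<longleftrightarrow>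
      integrable (gamma_law a b) (\<lambda>x. x powr 2 * (ln x)\<^sup>2)"
    by (rule integrable_cong_AE)
       (auto intro!: AE_gamma_lawI simp: power_mult_distrib)
  then show "integrable (gamma_law a b) (\<lambda>x. (x * ln x)\<^sup>2)"
    using gamma_law_tilt(1)[of a b 2 "\<lambda>x. (ln x)\<^sup>2"] ab
    by (simp add: gamma_law_ln_square_integrable)
  have "(LINT x|gamma_law a b. x) = (LINT x|gamma_law a b. x powr 1)"
    by (rule integral_cong_AE) (auto intro!: AE_gamma_lawI)
  also have "\<dots> = b powr 1 * Gamma (a + 1) / Gamma a"
    using ab by (intro gamma_law_powr(2)) auto
  finally show "(LINT x|gamma_law a b. x) = a * b"
    unfolding ratio .
  show "(LINT x|gamma_law a b. ln x) = Digamma a + ln b" by (rule gamma_law_ln[OF ab])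
  have "(LINT x|gamma_law a b. x * ln x) = (LINT x|gamma_law a b. x powr 1 * ln x)"
    by (rule integral_cong_AE) (auto intro!: AE_gamma_lawI)
  also have "\<dots> = b powr 1 * Gamma (a + 1) / Gamma a * (LINT x|gamma_law (a + 1) b. ln x)"
    using ab by (intro gamma_law_tilt(2)) auto
  also have "\<dots> = a * b * (Digamma (a + 1) + ln b)"
    unfolding ratio using ab by (subst gamma_law_ln) auto
  also have "\<dots> = a * b * (Digamma a + ln b) + b"
    using ab by (subst Digamma_plus1) (auto simp: field_simps)
  finally show "(LINT x|gamma_law a b. x * ln x) = a * b * (Digamma a + ln b) + b" .
qed

section \<open>Increments of the Multivariate Gamma distribution\<close>

lemma Max_below_less:
  fixes i :: "'k::{finite,wellorder}"
  assumes "{j. j < i} \<noteq> {}"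
  shows "Max {j. j < i} < i"
  using Max_in[OF _ assms] by simp

lemma sum_increments_atMost:
  fixes x :: "real ^ 'k::{finite,wellorder}"
  shows "(\<Sum>j\<in>{..i}. increments x $ j) = x $ i"
proof (induction i rule: less_induct)
  case (less i)
  show ?case
  proof (cases "{j. j < i} = {}")
    case True
    then have "{..i} = {i}" by (auto simp: set_eq_iff order.order_iff_strict)
    with True show ?thesis by (simp add: increments_def)
  next
    case False
    let ?p = "Max {j. j < i}"
    have p: "?p < i" by (rule Max_below_less[OF False])
    have "j \<le> ?p" if "j < i" for j
      using that by simp
    then have "{..i} = insert i {..?p}"
      using p by (auto simp: order.order_iff_strict[of _ i])
    moreover have "i \<notin> {..?p}" using p by auto
    ultimately have "(\<Sum>j\<in>{..i}. increments x $ j) = increments x $ i + x $ ?p"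
      using less.IH[OF p] by simp
    moreover have "increments x $ i = x $ i - x $ ?p"
      by (simp only: increments_def vec_lambda_beta False if_False)
    ultimately show ?thesis by simp
  qed
qed

lemma linear_increments: "linear (increments :: real ^ 'k::{finite,wellorder} \<Rightarrow> real ^ 'k::_)"
  by (rule linearI) (auto simp: increments_def vec_eq_iff algebra_simps)

lemma measurable_increments [measurable]:
  "(increments :: real ^ 'k::{finite,wellorder} \<Rightarrow> real ^ 'k::_) \<in> borel_measurable borel"
  by (intro borel_measurable_continuous_onI linear_continuous_on linear_conv_bounded_linear[THEN iffD1]
      linear_increments)

lemma inj_increments: "inj (increments :: real ^ 'k::{finite,wellorder} \<Rightarrow> real ^ 'k::_)"
proof (rule injI)
  fix x y :: "real ^ 'k::_"
  assume "increments x = increments y"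
  then show "x = y"
    using sum_increments_atMost[of x] sum_increments_atMost[of y] by (simp add: vec_eq_iff)
qed

text \<open>
  Row \<open>i\<close> of the matrix has its only other nonzero entry in the column of the predecessor of \<open>i\<close>, so the
  matrix is unit lower triangular.
\<close>

lemma det_increments: "det (matrix (increments :: real ^ 'k::{finite,wellorder} \<Rightarrow> real ^ 'k::_)) = 1"
proof -
  let ?A = "matrix (increments :: real ^ 'k::{finite,wellorder} \<Rightarrow> real ^ 'k::_)"
  have entry: "?A $ i $ j = (if i = j then 1 else 0)" if "i \<le> j" for i j
  proof (cases "{j. j < i} = {}")
    case True
    then show ?thesis by (simp add: matrix_def increments_def axis_def)
  next
    case False
    have "?A $ i $ j = axis j 1 $ i - axis j 1 $ Max {j. j < i}"
      by (simp only: matrix_def vec_lambda_beta increments_def False if_False)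
    moreover have "Max {j. j < i} \<noteq> j"
      by (rule less_imp_neq) (rule less_le_trans[OF Max_below_less[OF False] that])
    ultimately show ?thesis by (simp add: axis_def)
  qed
  have "det ?A = (\<Prod>i\<in>UNIV. ?A $ i $ i)"
    by (rule det_lowerdiagonal) (simp add: entry)
  then show ?thesis by (simp add: entry)
qed

lemma lborel_distr_increments:
  "distr lborel borel (increments :: real ^ 'k::{finite,wellorder} \<Rightarrow> real ^ 'k::_) = lborel"
proof (rule lborel_eqI[symmetric])
  fix l u :: "real ^ 'k::_"
  assume lu: "\<And>b. b \<in> Basis \<Longrightarrow> l \<bullet> b \<le> u \<bullet> b"
  let ?f = "increments :: real ^ 'k::_ \<Rightarrow> real ^ 'k::_"
  obtain g where g: "linear g" "\<And>x. g (?f x) = x" "\<And>x. ?f (g x) = x"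
    using linear_injective_isomorphism[OF linear_increments inj_increments] by blast
  have img: "?f -` box l u = g ` box l u"
    using g(2,3) by (intro set_eqI) (metis image_iff vimage_eq)
  have lm: "?f -` box l u \<in> lmeasurable"
    unfolding img by (intro measurable_linear_image g(1)) simp
  have "?f ` (?f -` box l u) = box l u"
    by (rule surj_image_vimage_eq) (metis g(3) surjI)
  then have "measure lebesgue (box l u) = measure lebesgue (?f -` box l u)"
    using measure_linear_image[OF linear_increments lm] by (simp add: det_increments)
  then have "emeasure lebesgue (?f -` box l u) = emeasure lebesgue (box l u)"
    using lm by (simp only: emeasure_eq_measure2 lmeasurable_box)
  moreover have "?f -` box l u \<in> sets borel"
    using measurable_sets[OF measurable_increments, of "box l u"] by simp
  ultimately have "emeasure lborel (?f -` box l u) = emeasure lborel (box l u)"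
    by simp
  then show "emeasure (distr lborel borel ?f) (box l u) = (\<Prod>b\<in>Basis. (u - l) \<bullet> b)"
    using lu by (subst emeasure_distr) simp_all
qed simp

lemma mg_support_iff_increments_pos:
  fixes x :: "real ^ 'k::{finite,wellorder}"
  shows "x \<in> mg_support \<longleftrightarrow> (\<forall>i. 0 < increments x $ i)"
proof
  assume x: "x \<in> mg_support"
  show "\<forall>i. 0 < increments x $ i"
  proof
    fix i
    show "0 < increments x $ i"
      using x Max_below_less[of i] by (auto simp: increments_def mg_support_def)
  qed
next
  assume pos: "\<forall>i. 0 < increments x $ i"
  have "0 < x $ i" for i
    using pos by (subst sum_increments_atMost[symmetric]) (intro sum_pos, auto)
  moreover have "x $ i < x $ j" if "i < j" for i j
  proof -
    have "(\<Sum>j\<in>{..i}. increments x $ j) < (\<Sum>j\<in>{..j}. increments x $ j)"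
      using that pos by (intro sum_strict_mono2[where b = j]) (auto simp: less_imp_le)
    then show ?thesis by (simp add: sum_increments_atMost)
  qed
  ultimately show "x \<in> mg_support" by (simp add: mg_support_def)
qed

text \<open>
  The increments of a Multivariate Gamma vector are independent Gamma variables with a common scale:
  the exponents combine because the last coordinate is the sum of all increments, and the support is
  where all increments are positive.
\<close>

lemma mg_density_eq_prod_gamma_density:
  fixes \<alpha> x :: "real ^ 'k::{finite,wellorder}"
  assumes "0 < \<beta>"
  shows "mg_density \<alpha> \<beta> x = (\<Prod>i\<in>UNIV. gamma_density (\<alpha> $ i) \<beta> (increments x $ i))"
proof (cases "x \<in> mg_support")
  case True
  then have pos: "0 < increments x $ i" for i by (simp add: mg_support_iff_increments_pos)
  have "{..Max UNIV} = (UNIV :: 'k set)" by (auto intro: Max_ge)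
  then have top: "x $ Max UNIV = (\<Sum>i\<in>UNIV. increments x $ i)"
    using sum_increments_atMost[of x "Max UNIV"] by simp
  have "(\<Prod>i\<in>UNIV. gamma_density (\<alpha> $ i) \<beta> (increments x $ i)) =
      (\<Prod>i\<in>UNIV. increments x $ i powr (\<alpha> $ i - 1)) * (\<Prod>i\<in>UNIV. exp (- (increments x $ i) / \<beta>)) /
      ((\<Prod>i\<in>UNIV. \<beta> powr (\<alpha> $ i)) * (\<Prod>i\<in>UNIV. Gamma (\<alpha> $ i)))"
    using pos by (simp add: gamma_density_def prod_dividef prod.distrib)
  also have "(\<Prod>i\<in>UNIV. exp (- (increments x $ i) / \<beta>)) = exp (- (x $ Max UNIV) / \<beta>)"
    by (simp add: top exp_sum[symmetric] sum_negf sum_divide_distrib)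
  also have "(\<Prod>i\<in>UNIV. \<beta> powr (\<alpha> $ i)) = \<beta> powr (\<Sum>i\<in>UNIV. \<alpha> $ i)"
    using assms by (simp add: powr_sum)
  finally show ?thesis using True by (simp add: mg_density_def mult_ac)
next
  case False
  then obtain i where "\<not> 0 < increments x $ i" by (auto simp: mg_support_iff_increments_pos)
  then have "gamma_density (\<alpha> $ i) \<beta> (increments x $ i) = 0" by (simp add: gamma_density_def)
  then have "(\<Prod>i\<in>UNIV. gamma_density (\<alpha> $ i) \<beta> (increments x $ i)) = 0"
    by (intro prod_zero) auto
  with False show ?thesis by (simp add: mg_density_def)
qed

lemma nn_integral_lborel_prod_vec:
  fixes f :: "'k::finite \<Rightarrow> real \<Rightarrow> ennreal"
  assumes [measurable]: "\<And>i. f i \<in> borel_measurable borel"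
  shows "(\<integral>\<^sup>+z. (\<Prod>i\<in>UNIV. f i (z $ i)) \<partial>(lborel :: (real ^ 'k) measure)) = (\<Prod>i\<in>UNIV. \<integral>\<^sup>+t. f i t \<partial>lborel)"
proof -
  have reindex: "(\<Prod>b\<in>(Basis :: (real ^ 'k) set). G b) = (\<Prod>i\<in>UNIV. G (axis i 1))" for G :: "real ^ 'k \<Rightarrow> ennreal"
  proof -
    have Basis_eq: "(Basis :: (real ^ 'k) set) = range (\<lambda>i. axis i 1)"
      by (auto simp: Basis_vec_def)
    have "inj (\<lambda>i :: 'k. axis i (1 :: real))" by (auto simp: inj_def axis_eq_axis)
    then show ?thesis
      unfolding Basis_eq by (subst prod.reindex) (simp_all add: o_def)
  qed
  have "(\<integral>\<^sup>+z. (\<Prod>b\<in>Basis. f (axis_index b) (z \<bullet> b)) \<partial>(lborel :: (real ^ 'k) measure)) =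
      (\<Prod>b\<in>(Basis :: (real ^ 'k) set). \<integral>\<^sup>+t. f (axis_index b) t \<partial>lborel)"
    by (rule nn_integral_lborel_prod) auto
  then show ?thesis
    unfolding reindex by (simp add: inner_axis)
qed

text \<open>
  In the coordinates given by the increments the law is a product, and the factors other than the
  \<open>i\<close>-th integrate to 1. These marginals suffice for the means and the square integrability of the
  components of \<^const>\<open>same_h\<close>, each of which is a function of a single increment.
\<close>

lemma gamma_marginals_of_mg:
  fixes \<alpha> :: "real ^ 'k::{finite,wellorder}"
  assumes \<alpha>: "\<And>i. 0 < \<alpha> $ i" and \<beta>: "0 < \<beta>"
  shows "distr (density lborel (\<lambda>x. ennreal (mg_density \<alpha> \<beta> x))) borel (\<lambda>x. increments x $ i) = gamma_law (\<alpha> $ i) \<beta>"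
    (is "distr ?P _ _ = _")
proof (rule measure_eqI)
  fix A assume "A \<in> sets (distr ?P borel (\<lambda>x. increments x $ i))"
  then have A [measurable]: "A \<in> sets borel" by simp
  let ?p = "\<lambda>j t. ennreal (gamma_density (\<alpha> $ j) \<beta> t)"
  let ?f = "\<lambda>j t. ?p j t * (if j = i then indicator A t else 1)"
  have [measurable]: "(\<lambda>x. mg_density \<alpha> \<beta> x) \<in> borel_measurable borel"
    unfolding mg_density_eq_prod_gamma_density[OF \<beta>] by measurable
  have "(\<lambda>x. increments x $ i) -` A \<in> sets borel"
    using measurable_sets[of "\<lambda>x. increments x $ i" borel borel A] by simp
  then have "emeasure (distr ?P borel (\<lambda>x. increments x $ i)) A =
      (\<integral>\<^sup>+x. ennreal (mg_density \<alpha> \<beta> x) * indicator A (increments x $ i) \<partial>lborel)"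
    by (subst emeasure_distr) (auto simp: emeasure_density indicator_def intro!: nn_integral_cong)
  also have "\<dots> = (\<integral>\<^sup>+x. (\<Prod>j\<in>UNIV. ?f j (increments x $ j)) \<partial>lborel)"
  proof (rule nn_integral_cong)
    fix x :: "real ^ 'k::_"
    have "ennreal (mg_density \<alpha> \<beta> x) = (\<Prod>j\<in>UNIV. ?p j (increments x $ j))"
      unfolding mg_density_eq_prod_gamma_density[OF \<beta>]
      using gamma_density_nonneg[OF \<alpha> \<beta>] by (simp add: prod_ennreal)
    moreover have "(\<Prod>j\<in>UNIV. if j = i then indicator A (increments x $ j) else 1) =
        (indicator A (increments x $ i) :: ennreal)"
      by simp
    ultimately show "ennreal (mg_density \<alpha> \<beta> x) * indicator A (increments x $ i) =
        (\<Prod>j\<in>UNIV. ?f j (increments x $ j))"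
      unfolding prod.distrib by simp
  qed
  also have "\<dots> = (\<integral>\<^sup>+z. (\<Prod>j\<in>UNIV. ?f j (z $ j)) \<partial>distr lborel borel (increments :: real ^ 'k::_ \<Rightarrow> _))"
    by (subst nn_integral_distr) auto
  also have "\<dots> = (\<Prod>j\<in>UNIV. \<integral>\<^sup>+t. ?f j t \<partial>lborel)"
    unfolding lborel_distr_increments by (rule nn_integral_lborel_prod_vec) simp
  also have "\<dots> = (\<Prod>j\<in>UNIV. if j = i then emeasure (gamma_law (\<alpha> $ i) \<beta>) A else 1)"
  proof (rule prod.cong)
    fix j
    show "(\<integral>\<^sup>+t. ?f j t \<partial>lborel) = (if j = i then emeasure (gamma_law (\<alpha> $ i) \<beta>) A else 1)"
      by (auto simp: nn_integral_gamma_density[OF \<alpha> \<beta>] gamma_law_def emeasure_density)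
  qed simp
  also have "\<dots> = emeasure (gamma_law (\<alpha> $ i) \<beta>) A" by simp
  finally show "emeasure (distr ?P borel (\<lambda>x. increments x $ i)) A = emeasure (gamma_law (\<alpha> $ i) \<beta>) A" .
qed (simp add: gamma_law_def)

section \<open>The Score-Adjusted Moment Estimator\<close>

lemma mg_param_components [simp]:
  "mg_param \<alpha> \<beta> $ Inl j = \<alpha> $ j" "mg_param \<alpha> \<beta> $ Inr u = \<beta>"
  by (simp_all add: mg_param_def)

lemma mg_param_eta: "mg_param (\<chi> j. \<theta> $ Inl j) (\<theta> $ Inr ()) = \<theta>"
  by (auto simp: vec_eq_iff mg_param_def split: sum.split)

lemma mg_measure_mg_param: "mg_measure (mg_param \<alpha> \<beta>) = density lborel (\<lambda>x. ennreal (mg_density \<alpha> \<beta> x))"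
  by (simp add: mg_measure_def)

lemma mg_param_space_iff: "mg_param \<alpha> \<beta> \<in> mg_param_space \<longleftrightarrow> (\<forall>i. 0 < \<alpha> $ i) \<and> 0 < \<beta>"
  by (auto simp: mg_param_space_def mg_param_def split: sum.splits)

lemma open_mg_param_space: "open (mg_param_space :: (real ^ ('k::finite + unit)) set)"
proof -
  have eq: "mg_param_space = (\<Inter>i. {\<theta> :: real ^ ('k + unit). 0 < \<theta> $ i})"
    by (auto simp: mg_param_space_def)
  have "open {\<theta> :: real ^ ('k + unit). 0 < \<theta> $ i}" for i
    by (intro open_Collect_less continuous_intros)
  then show ?thesis unfolding eq by (intro open_INT) auto
qed

lemma measurable_same_h [measurable]:
  "(same_h :: real ^ 'k::{finite,wellorder} \<Rightarrow> _) \<in> borel_measurable borel"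
proof (rule measurable_vec_lambda)
  fix c :: "'k + 'k + 'k"
  show "(\<lambda>x. same_h x $ c) \<in> borel_measurable borel"
    by (cases c rule: sum.exhaust; (cases "projr c" rule: sum.exhaust)?) (simp_all add: same_h_def)
qed

lemma measurable_same_g [measurable]:
  "(same_g :: real ^ ('k::finite + 'k + 'k) \<Rightarrow> _) \<in> borel_measurable borel"
proof (rule measurable_vec_lambda)
  fix r :: "'k + unit"
  show "(\<lambda>y. same_g y $ r) \<in> borel_measurable borel"
    by (cases r) (simp_all add: same_g_def Let_def)
qed

lemma same_estimator_eq: "same_estimator N x = same_g (sample_mean N (\<lambda>n. same_h (x n)))"
  by (simp add: same_estimator_def same_g_def same_alpha_def same_beta_def same_h_def sample_mean_def Let_def)

text \<open>
  The value of the moment map \<open>e\<close> at \<open>(\<alpha>, \<beta>)\<close>.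
\<close>

definition mg_h_mean :: "real ^ 'k::finite \<Rightarrow> real \<Rightarrow> real ^ ('k + 'k + 'k)" where
  "mg_h_mean \<alpha> \<beta> = (\<chi> c. case c of
       Inl j \<Rightarrow> \<alpha> $ j * \<beta>
     | Inr (Inl j) \<Rightarrow> Digamma (\<alpha> $ j) + ln \<beta>
     | Inr (Inr j) \<Rightarrow> \<alpha> $ j * \<beta> * (Digamma (\<alpha> $ j) + ln \<beta>) + \<beta>)"

text \<open>
  The covariance of an increment and its logarithm is \<open>\<beta>\<close>, whatever the shape; averaging over the
  increments recovers \<open>\<beta>\<close>, and the means \<open>\<alpha> $ j * \<beta>\<close> then give \<open>\<alpha>\<close>.
\<close>

lemma same_g_mg_h_mean:
  assumes "0 < \<beta>"
  shows "same_g (mg_h_mean \<alpha> \<beta>) = mg_param \<alpha> \<beta>"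
proof -
  have "(\<Sum>j\<in>UNIV. (mg_h_mean \<alpha> \<beta> $ Inr (Inr j) - mg_h_mean \<alpha> \<beta> $ Inl j * mg_h_mean \<alpha> \<beta> $ Inr (Inl j))) =
      real CARD('a) * \<beta>"
    by (simp add: mg_h_mean_def)
  moreover have "mg_h_mean \<alpha> \<beta> $ Inl i = \<alpha> $ i * \<beta>" for i
    by (simp add: mg_h_mean_def)
  ultimately show ?thesis
    using assms by (simp add: same_g_def)
qed

lemma same_h_moments:
  fixes \<alpha> :: "real ^ 'k::{finite,wellorder}"
  assumes \<alpha>: "\<And>i. 0 < \<alpha> $ i" and \<beta>: "0 < \<beta>"
  shows "integrable (mg_measure (mg_param \<alpha> \<beta>)) (\<lambda>x. (same_h x $ c)\<^sup>2)"
    and "integrable (mg_measure (mg_param \<alpha> \<beta>)) same_h"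
    and "(LINT x|mg_measure (mg_param \<alpha> \<beta>). same_h x) = mg_h_mean \<alpha> \<beta>"
proof -
  let ?P = "mg_measure (mg_param \<alpha> \<beta>)"
  have sets_P [measurable_cong]: "sets ?P = sets borel" by (simp add: mg_measure_mg_param)
  have law: "gamma_law (\<alpha> $ i) \<beta> = distr ?P borel (\<lambda>x. increments x $ i)" for i
    unfolding mg_measure_mg_param by (rule gamma_marginals_of_mg[OF \<alpha> \<beta>, symmetric])
  have transfer: "integrable ?P (\<lambda>x. f (increments x $ i)) \<longleftrightarrow> integrable (gamma_law (\<alpha> $ i) \<beta>) f"
    "(LINT x|?P. f (increments x $ i)) = (LINT t|gamma_law (\<alpha> $ i) \<beta>. f t)"
    if "f \<in> borel_measurable borel" for f :: "real \<Rightarrow> real" and i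
    unfolding law using that by (simp_all add: integrable_distr_eq integral_distr)
  have "emeasure ?P (space ?P) = emeasure (gamma_law (\<alpha> $ undefined) \<beta>) (space (gamma_law (\<alpha> $ undefined) \<beta>))"
    unfolding law by (subst emeasure_distr) auto
  then interpret prob_space ?P
    using prob_space.emeasure_space_1[OF prob_space_gamma_law[OF \<alpha> \<beta>]] by (intro prob_spaceI) simp
  note moments = gamma_law_moments[OF \<alpha> \<beta>]
  show sq: "integrable ?P (\<lambda>x. (same_h x $ c)\<^sup>2)" for c
  proof (cases c)
    case (Inl j)
    then show ?thesis
      using transfer(1)[of "\<lambda>t. t\<^sup>2" j] moments(1)[of j] by (simp add: same_h_def)
  next
    case (Inr d)
    then show ?thesis
      using transfer(1)[of "\<lambda>t. (ln t)\<^sup>2"] transfer(1)[of "\<lambda>t. (t * ln t)\<^sup>2"] moments(2,3)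
      by (cases d) (simp_all add: same_h_def)
  qed
  have "integrable ?P (\<lambda>x. same_h x $ c)" for c
    by (rule square_integrable_imp_integrable[OF _ sq]) simp
  then show int: "integrable ?P same_h" by (rule integrable_vec)
  show "(LINT x|?P. same_h x) = mg_h_mean \<alpha> \<beta>"
  proof (rule vec_eq_iff[THEN iffD2], rule allI)
    fix c
    have "(LINT x|?P. same_h x) $ c = (LINT x|?P. same_h x $ c)" by (rule integral_vec_nth[OF int])
    also have "\<dots> = mg_h_mean \<alpha> \<beta> $ c"
    proof (cases c)
      case (Inl j)
      then show ?thesis
        using transfer(2)[of "\<lambda>t. t" j] moments(4)[of j] by (simp add: same_h_def mg_h_mean_def)
    next
      case (Inr d)
      then show ?thesis
        using transfer(2)[of ln] transfer(2)[of "\<lambda>t. t * ln t"] moments(5,6)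
        by (cases d) (simp_all add: same_h_def mg_h_mean_def)
    qed
    finally show "(LINT x|?P. same_h x) $ c = mg_h_mean \<alpha> \<beta> $ c" .
  qed
qed

lemma sum_UNIV_sum_type:
  fixes f :: "'a::finite + 'b::finite \<Rightarrow> real"
  shows "(\<Sum>c\<in>UNIV. f c) = (\<Sum>a\<in>UNIV. f (Inl a)) + (\<Sum>b\<in>UNIV. f (Inr b))"
  unfolding UNIV_Plus_UNIV[symmetric] by (subst sum.Plus) (simp_all add: o_def)

lemma has_derivative_vecI:
  fixes f :: "'a::real_normed_vector \<Rightarrow> real ^ 'n"
  assumes "\<And>i. ((\<lambda>x. f x $ i) has_derivative (\<lambda>x. f' x $ i)) (at a within S)"
  shows "(f has_derivative f') (at a within S)"
  using assms by (subst has_derivative_componentwise_within) (auto simp: Basis_vec_def inner_axis)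

text \<open>
  The last component of \<^const>\<open>same_g\<close> is a quadratic polynomial \<open>b\<close>, and the others are \<open>y $ Inl i / b y\<close>.
  As \<open>b\<close> takes the value \<open>\<beta>\<close> at the mean, the quotient rule expresses the first \<open>k\<close> rows of the Jacobian
  through the last one: the row of \<open>i\<close> is the unit row divided by \<open>\<beta>\<close>, minus \<open>\<alpha> $ i / \<beta>\<close> times the
  last row.
\<close>

lemma same_g_has_derivative:
  assumes "0 < \<beta>"
  shows "(same_g has_derivative (\<lambda>v. same_G \<alpha> \<beta> *v v)) (at (mg_h_mean \<alpha> \<beta>))"
proof -
  let ?m = "mg_h_mean \<alpha> \<beta>" and ?k = "real CARD('a)"
  define b where "b y = (1 / ?k) * (\<Sum>j\<in>UNIV. (y $ Inr (Inr j) - y $ Inl j * y $ Inr (Inl j)))"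
    for y :: "real ^ ('a + 'a + 'a)"
  define db where "db v = (1 / ?k) * (\<Sum>j\<in>UNIV. (v $ Inr (Inr j) -
      (?m $ Inl j * v $ Inr (Inl j) + v $ Inl j * ?m $ Inr (Inl j))))" for v :: "real ^ ('a + 'a + 'a)"
  have m: "?m $ Inl j = \<alpha> $ j * \<beta>" "?m $ Inr (Inl j) = Digamma (\<alpha> $ j) + ln \<beta>" for j
    by (simp_all add: mg_h_mean_def)
  have g: "same_g y $ Inl i = y $ Inl i / b y" "same_g y $ Inr u = b y" for y i u
    by (simp_all add: same_g_def b_def Let_def)
  have "b ?m = \<beta>"
    using same_g_mg_h_mean[OF assms, of \<alpha>] g(2)[of ?m "()"] by simp
  have deriv_b: "(b has_derivative db) (at ?m)"
    unfolding b_def db_def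
    by (auto intro!: derivative_eq_intros bounded_linear_imp_has_derivative[OF bounded_linear_vec_nth])
  have row_b: "(same_G \<alpha> \<beta> *v v) $ Inr u = db v" for v u
    by (simp add: matrix_vector_mult_def same_G_def Let_def sum_UNIV_sum_type db_def m
        sum_subtractf sum.distrib sum_distrib_left sum_divide_distrib sum_negf algebra_simps)
  have row_a: "(same_G \<alpha> \<beta> *v v) $ Inl i = v $ Inl i / \<beta> - \<alpha> $ i / \<beta> * db v" for v i
  proof -
    have "(same_G \<alpha> \<beta> *v v) $ Inl i = (\<Sum>j\<in>UNIV.
        (\<alpha> $ i / (?k * \<beta>) * (Digamma (\<alpha> $ j) + ln \<beta>) + (1 / \<beta>) * (if i = j then 1 else 0)) * v $ Inl j +
        (\<alpha> $ i * \<alpha> $ j / ?k * v $ Inr (Inl j) + - (\<alpha> $ i / (?k * \<beta>)) * v $ Inr (Inr j)))"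
      unfolding sum.distrib by (simp add: matrix_vector_mult_def same_G_def Let_def sum_UNIV_sum_type)
    also have "\<dots> = (\<Sum>j\<in>UNIV. (if i = j then v $ Inl j / \<beta> else 0) -
        \<alpha> $ i / \<beta> * (1 / ?k) * (v $ Inr (Inr j) -
          (?m $ Inl j * v $ Inr (Inl j) + v $ Inl j * ?m $ Inr (Inl j))))"
      using assms by (intro sum.cong refl) (simp add: m field_simps)
    also have "\<dots> = v $ Inl i / \<beta> - \<alpha> $ i / \<beta> * db v"
      by (subst sum_subtractf) (simp add: db_def sum_distrib_left sum_divide_distrib)
    finally show ?thesis .
  qed
  show ?thesis
  proof (rule has_derivative_vecI)
    fix r
    show "((\<lambda>y. same_g y $ r) has_derivative (\<lambda>v. (same_G \<alpha> \<beta> *v v) $ r)) (at ?m)"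
    proof (cases r)
      case (Inl i)
      have "((\<lambda>y. y $ Inl i / b y) has_derivative
          (\<lambda>v. (v $ Inl i * b ?m - ?m $ Inl i * db v) / (b ?m * b ?m))) (at ?m)"
        using \<open>b ?m = \<beta>\<close> assms deriv_b
        by (intro has_derivative_divide' bounded_linear_imp_has_derivative bounded_linear_vec_nth) auto
      moreover have "(v $ Inl i * b ?m - ?m $ Inl i * db v) / (b ?m * b ?m) = v $ Inl i / \<beta> - \<alpha> $ i / \<beta> * db v" for v
        using assms by (simp add: \<open>b ?m = \<beta>\<close> m field_simps)
      ultimately show ?thesis unfolding Inl g row_a by simp
    next
      case (Inr u)
      show ?thesis unfolding Inr g row_b by (rule deriv_b)
    qed
  qed
qed

text \<open>
  The moment map is injective because \<^const>\<open>same_g\<close> is a left inverse of it.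
\<close>

lemma same_moment_type_estimator:
  "moment_type_estimator mg_measure mg_param_space (mg_support :: (real ^ 'k::{finite,wellorder}) set)
     same_h same_g same_estimator"
proof -
  let ?e = "\<lambda>\<theta> :: real ^ ('k + unit). LINT x|mg_measure \<theta>. same_h x"
  have *: "integrable (mg_measure \<theta>) same_h" "same_g (?e \<theta>) = \<theta>" if "\<theta> \<in> mg_param_space" for \<theta> :: "real ^ ('k + unit)"
  proof -
    define \<alpha> where "\<alpha> = (\<chi> j. \<theta> $ Inl j)"
    define \<beta> where "\<beta> = \<theta> $ Inr ()"
    have \<theta>: "\<theta> = mg_param \<alpha> \<beta>" by (simp add: \<alpha>_def \<beta>_def mg_param_eta)
    with that have "\<And>i. 0 < \<alpha> $ i" "0 < \<beta>" by (auto simp: mg_param_space_iff)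
    then show "integrable (mg_measure \<theta>) same_h" "same_g (?e \<theta>) = \<theta>"
      unfolding \<theta> by (simp_all add: same_h_moments same_g_mg_h_mean)
  qed
  then have inj: "inj_on ?e mg_param_space"
    by (intro inj_on_inverseI[of _ same_g]) blast
  have g_inv: "same_g (?e \<theta>) = inv_into mg_param_space ?e (?e \<theta>)" if "\<theta> \<in> mg_param_space" for \<theta>
    unfolding inv_into_f_f[OF inj that] by (rule *(2)[OF that])
  show ?thesis
    unfolding moment_type_estimator_def Let_def
  proof (intro conjI)
    show "\<forall>\<theta>\<in>(mg_param_space :: (real ^ ('k + unit)) set). integrable (mg_measure \<theta>) same_h"
      by (intro ballI *(1))
    show "inj_on ?e mg_param_space" by (rule inj)
    show "\<forall>y\<in>?e ` mg_param_space. same_g y = inv_into mg_param_space ?e y"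
      by (intro ballI) (elim imageE, simp only: g_inv)
  qed (simp add: same_estimator_eq)
qed

theorem theorem4p7:
  fixes \<alpha> :: "real ^ 'k::{finite,wellorder}" and \<beta> :: real
    and M :: "'a measure" and X :: "nat \<Rightarrow> 'a \<Rightarrow> real ^ 'k::_"
  assumes "\<And>i. 0 < \<alpha> $ i" and "0 < \<beta>"
    and "prob_space M"
    and "prob_space.indep_vars M (\<lambda>_. borel) X UNIV"
    and "\<And>n. distributed M lborel (X n) (\<lambda>x. ennreal (mg_density \<alpha> \<beta> x))"
  shows "moment_type_estimator mg_measure mg_param_space (mg_support :: (real ^ 'k::_) set)
           same_h same_g same_estimator
         \<and> (\<forall>i. integrable (mg_measure (mg_param \<alpha> \<beta>)) (\<lambda>x. (same_h x $ i)\<^sup>2))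
         \<and> has_asymptotic_cov M (\<lambda>N \<omega>. same_estimator N (\<lambda>n. X n \<omega>)) mg_param_space (mg_param \<alpha> \<beta>)
             (same_G \<alpha> \<beta> ** cov_matrix (mg_measure (mg_param \<alpha> \<beta>)) same_h ** transpose (same_G \<alpha> \<beta>))"
proof (intro conjI allI)
  let ?P = "mg_measure (mg_param \<alpha> \<beta>)"
  show "moment_type_estimator mg_measure mg_param_space (mg_support :: (real ^ 'k::_) set)
      same_h same_g same_estimator"
    by (rule same_moment_type_estimator)
  show sq: "integrable ?P (\<lambda>x. (same_h x $ i)\<^sup>2)" for i
    by (rule same_h_moments(1)[OF assms(1,2)])
  have law: "distr M borel (X n) = ?P" for n
  proof -
    have "distr M borel (X n) = distr M lborel (X n)" by (intro distr_cong) auto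
    then show ?thesis
      using assms(5)[of n] by (simp add: distributed_def mg_measure_mg_param)
  qed
  have mean: "(LINT x|?P. same_h x) = mg_h_mean \<alpha> \<beta>"
    by (rule same_h_moments(3)[OF assms(1,2)])
  have param: "same_g (LINT x|?P. same_h x) = mg_param \<alpha> \<beta>"
    unfolding mean by (rule same_g_mg_h_mean[OF assms(2)])
  have "has_asymptotic_cov M (\<lambda>N \<omega>. same_g (sample_mean N (\<lambda>n. same_h (X n \<omega>)))) mg_param_space
      (same_g (LINT x|?P. same_h x))
      (same_G \<alpha> \<beta> ** cov_matrix ?P same_h ** transpose (same_G \<alpha> \<beta>))"
  proof (rule delta_method_iid[OF assms(3,4) law measurable_same_h measurable_same_g sq])
    show "(same_g has_derivative (\<lambda>v. same_G \<alpha> \<beta> *v v)) (at (LINT x|?P. same_h x))"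
      unfolding mean by (rule same_g_has_derivative[OF assms(2)])
    show "same_g (LINT x|?P. same_h x) \<in> mg_param_space"
      unfolding param using assms(1,2) by (simp add: mg_param_space_iff)
  qed (rule open_mg_param_space)
  then show "has_asymptotic_cov M (\<lambda>N \<omega>. same_estimator N (\<lambda>n. X n \<omega>)) mg_param_space (mg_param \<alpha> \<beta>)
      (same_G \<alpha> \<beta> ** cov_matrix ?P same_h ** transpose (same_G \<alpha> \<beta>))"
    unfolding param same_estimator_eq .
qed

end
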